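(* Let $G,H$ be in the same connected component of $O_n$. The curves of minimal length among the curves in $(O_n,g)$ joining $G$ and $H$ are precisely the principal geodesic arcs, i.e. the curves $\alpha:[0,1]\to O_n$ of type $\alpha(t)=G\exp(tB)$, where $B$ is any real skew symmetric principal logarithm of $G^{-1}H$. Moreover, denoting by $d$ the distance associated to the metric $g$, we have $$d(G,H)=\sqrt{\sum_{j=1}^n|\log\mu_j|^2},$$ where $\mu_1,\dots,\mu_n$ are the (possibly repeated) $n$ eigenvalues of $G^{-1}H$ and $\log\mu$ denotes the principal complex logarithm of the complex number $\mu$.
   Context: $O_n$ is the group of real orthogonal matrices of order $n$ with the Riemannian metric $g(V,W)=\operatorname{tr}(V^TW)$ induced by the Frobenius metric. $SO_n$ is the subgroup of matrices of determinant $1$; if $G,H$ are in the same connected component of $O_n$ then $G^{-1}H\in SO_n$. A real skew symmetric principal logarithm of $R\in SO_n$ is a real skew symmetric matrix $B$ with $\exp(B)=R$ all of whose (complex) eigenvalues have absolute value in $[0,\pi]$. The principal complex logarithm has imaginary part in $(-\pi,\pi]$ (so $|\log(-1)|=\pi$). *)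

theory Defs
  imports "HOL-Analysis.Analysis" "HOL-Computational_Algebra.Polynomial"
begin

section \<open>The orthogonal group with the Frobenius metric\<close>

definition orthogonal_group :: "(real^'n^'n) set" where
  "orthogonal_group = {A. orthogonal_matrix A}"

definition frob_metric :: "real^'n^'n \<Rightarrow> real^'n^'n \<Rightarrow> real" where
  "frob_metric V W = trace (transpose V ** W)"

section \<open>Curves, length and distance\<close>

definition C1_on_interval :: "(real \<Rightarrow> 'a::real_normed_vector) \<Rightarrow> real \<Rightarrow> real \<Rightarrow> bool" where
  "C1_on_interval f a b \<longleftrightarrow>
     (\<exists>f'. continuous_on {a..b} f' \<and>
        (\<forall>t\<in>{a..b}. (f has_vector_derivative f' t) (at t within {a..b})))"

text \<open>
  The curve is required to be \<open>C\<^sup>1\<close> (with one-sided derivatives) on each closed piece. The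
  library predicate \<^const>\<open>piecewise_C1_differentiable_on\<close> is weaker: it leaves the derivative
  unconstrained near the break points, so it admits curves of infinite length, to which the
  (total) function \<^const>\<open>integral\<close> would assign length 0.
\<close>

definition piecewise_C1 :: "(real \<Rightarrow> 'a::real_normed_vector) \<Rightarrow> bool" where
  "piecewise_C1 f \<longleftrightarrow>
     (\<exists>(p :: nat \<Rightarrow> real) k. p 0 = 0 \<and> p k = 1 \<and>
        (\<forall>i<k. p i < p (Suc i) \<and> C1_on_interval f (p i) (p (Suc i))))"

text \<open>
  Curves are parametrised by \<open>[0,1]\<close>; their values outside this interval are irrelevant. As
  \<open>O\<^sub>n\<close> is an embedded submanifold of the space of matrices, a curve is (piecewise) \<open>C\<^sup>1\<close> in
  \<open>O\<^sub>n\<close> iff it is so as a matrix-valued function, with the same velocity.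
\<close>

definition curve_joining :: "real^'n^'n \<Rightarrow> real^'n^'n \<Rightarrow> (real \<Rightarrow> real^'n^'n) \<Rightarrow> bool" where
  "curve_joining G H \<gamma> \<longleftrightarrow>
     piecewise_C1 \<gamma> \<and> \<gamma> ` {0..1} \<subseteq> orthogonal_group \<and> \<gamma> 0 = G \<and> \<gamma> 1 = H"

text \<open>
  At the finitely many break points \<^const>\<open>vector_derivative\<close> may be arbitrary, which does not
  affect the integral.
\<close>

definition arc_length :: "(real \<Rightarrow> real^'n^'n) \<Rightarrow> real \<Rightarrow> real \<Rightarrow> real" where
  "arc_length \<gamma> a b =
     integral {a..b} (\<lambda>t. let V = vector_derivative \<gamma> (at t within {a..b})
                           in sqrt (frob_metric V V))"

definition curve_length :: "(real \<Rightarrow> real^'n^'n) \<Rightarrow> real" where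
  "curve_length \<gamma> = arc_length \<gamma> 0 1"

definition minimal_curve :: "real^'n^'n \<Rightarrow> real^'n^'n \<Rightarrow> (real \<Rightarrow> real^'n^'n) \<Rightarrow> bool" where
  "minimal_curve G H \<gamma> \<longleftrightarrow>
     curve_joining G H \<gamma> \<and> (\<forall>\<delta>. curve_joining G H \<delta> \<longrightarrow> curve_length \<gamma> \<le> curve_length \<delta>)"

definition const_speed :: "(real \<Rightarrow> real^'n^'n) \<Rightarrow> bool" where
  "const_speed \<gamma> \<longleftrightarrow>
     (\<exists>c. \<forall>s t. 0 \<le> s \<and> s \<le> t \<and> t \<le> 1 \<longrightarrow> arc_length \<gamma> s t = c * (t - s))"

definition reparametrization :: "(real \<Rightarrow> real) \<Rightarrow> bool" where
  "reparametrization s \<longleftrightarrow> piecewise_C1 s \<and> mono_on {0..1} s \<and> s 0 = 0 \<and> s 1 = 1"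

text \<open>
  Meaningful for \<open>G\<close>, \<open>H\<close> in the same component of \<open>O\<^sub>n\<close>; otherwise no curve joins them and
  the infimum of the empty set of reals carries no information.
\<close>

definition riem_dist :: "real^'n^'n \<Rightarrow> real^'n^'n \<Rightarrow> real" where
  "riem_dist G H = Inf {curve_length \<gamma> | \<gamma>. curve_joining G H \<gamma>}"

section \<open>Matrix exponential, eigenvalues, principal logarithms\<close>

text \<open>
  The type \<open>real^'n^'n\<close> carries the entrywise product as \<open>(*)\<close>, so the library's
  \<^const>\<open>exp\<close> and \<open>(^)\<close> are not available for the matrix product \<open>(**)\<close>.
\<close>

definition matpow :: "real^'n^'n \<Rightarrow> nat \<Rightarrow> real^'n^'n" where
  "matpow A k = (((**) A) ^^ k) (mat 1)"

definition mexp :: "real^'n^'n \<Rightarrow> real^'n^'n" where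
  "mexp A = (\<Sum>k. matpow A k /\<^sub>R fact k)"

definition complexify :: "real^'n^'n \<Rightarrow> complex^'n^'n" where
  "complexify A = map_matrix complex_of_real A"

definition eigenvalue :: "complex^'n^'n \<Rightarrow> complex \<Rightarrow> bool" where
  "eigenvalue A z \<longleftrightarrow> (\<exists>v. v \<noteq> 0 \<and> A *v v = z *s v)"

definition charpoly :: "complex^'n^'n \<Rightarrow> complex poly" where
  "charpoly A = det (\<chi> i j. (if i = j then [:0, 1:] else 0) - [:A $ i $ j:])"

text \<open>The eigenvalues repeated according to algebraic multiplicity.\<close>

definition eigenvalues :: "complex^'n^'n \<Rightarrow> complex multiset" where
  "eigenvalues A = proots (charpoly A)"

definition skew_principal_log :: "real^'n^'n \<Rightarrow> real^'n^'n \<Rightarrow> bool" where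
  "skew_principal_log R B \<longleftrightarrow>
     transpose B = - B \<and> mexp B = R \<and>
     (\<forall>z. eigenvalue (complexify B) z \<longrightarrow> cmod z \<in> {0..pi})"

definition principal_geodesic_arc ::
    "real^'n^'n \<Rightarrow> real^'n^'n \<Rightarrow> (real \<Rightarrow> real^'n^'n) \<Rightarrow> bool" where
  "principal_geodesic_arc G H \<alpha> \<longleftrightarrow>
     (\<exists>B. skew_principal_log (matrix_inv G ** H) B \<and>
          (\<forall>t\<in>{0..1}. \<alpha> t = G ** mexp (t *\<^sub>R B)))"

end

theory Submission
  imports Defs
begin

text \<open>
  Put \<open>R = G\<^sup>T H\<close>. The symmetric matrix \<open>R + R\<^sup>T\<close> has a real orthonormal eigenframe \<open>v\<^sub>j\<close> with
  eigenvalues \<open>2 cos \<theta>\<^sub>j\<close>, \<open>\<theta>\<^sub>j \<in> [0, \<pi>]\<close>; since \<open>(z - R)(z - R\<^sup>T) = z\<^sup>2 + 1 - z (R + R\<^sup>T)\<close>, the eigenvalues of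
  \<open>R\<close>, each counted twice, are the numbers \<open>exp (\<plusminus> i \<theta>\<^sub>j)\<close>. Along a curve \<open>\<gamma>\<close> from \<open>G\<close> to \<open>H\<close> the vector
  \<open>\<gamma>(t) v\<^sub>j\<close> moves on the unit sphere from \<open>G v\<^sub>j\<close> to \<open>H v\<^sub>j\<close>, which are at angle \<open>\<theta>\<^sub>j\<close>, and
  \<open>|\<gamma>'|\<^sup>2 = \<Sum>\<^sub>j |\<gamma>' v\<^sub>j|\<^sup>2\<close>; hence the length is at least \<open>L = (\<Sum>\<^sub>j \<theta>\<^sub>j\<^sup>2)\<^sup>1\<^sup>/\<^sup>2\<close>, and principal geodesic
  arcs attain this bound. If the length equals \<open>L\<close>, all these inequalities are equalities: with \<open>s(t)\<close> the
  normalised arc length, each \<open>\<gamma>(t) v\<^sub>j\<close> runs along a great circle at angle \<open>s(t) \<theta>\<^sub>j\<close>, and orthogonality of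
  \<open>\<gamma>(t)\<close> for all \<open>t\<close> forces the initial velocity \<open>B\<close> to be skew with \<open>B\<^sup>2 v\<^sub>j = - \<theta>\<^sub>j\<^sup>2 v\<^sub>j\<close>, whence
  \<open>\<gamma>(t) = G exp (s(t) B)\<close>.
\<close>

section \<open>Symmetric matrices and orthonormal frames\<close>

text \<open>The frame diagonalises \<open>R + transpose R\<close>, not \<open>R\<close>. Everything
  thus stays real and no normal form of \<open>R\<close> has to be built, but multiplicities become
  visible only through the square of the characteristic polynomial. The angles of all frame vectors
  are collected into one point of Euclidean space that never moves faster than the curve; strict
  convexity of the Euclidean norm is what forces these angles to grow in the fixed proportion
  \<theta> when no length is wasted. Two degeneracies shape the details. The function
  \<open>arccos\<close> is not differentiable at 1 and -1, and angles measured from a point of the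
  curve start there. And the eigenvalue -1 leaves rotation planes undetermined: antipodal points lie
  on many common great circles, so the direction of motion has to be read off halfway, and a
  principal logarithm has to choose planes inside the eigenspace of -1. Such a choice exists because
  \<open>det R = 1\<close> makes the dimension of that eigenspace even, and its freedom is the
  source of the many logarithms.\<close>

lemma selfadjoint_eigenvector:
  fixes f :: "'a::euclidean_space \<Rightarrow> 'a"
  assumes f: "linear f" and adj: "\<And>x y. f x \<bullet> y = x \<bullet> f y"
    and S: "subspace S" "f ` S \<subseteq> S" "S \<noteq> {0}"
  obtains x c where "x \<in> S" "norm x = 1" "f x = c *\<^sub>R x"
proof -
  have "compact (S \<inter> sphere 0 1)"
    using closed_subspace[OF S(1)] by (simp add: closed_Int_compact)
  moreover have "S \<inter> sphere 0 1 \<noteq> {}"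
  proof -
    obtain y where "y \<in> S" "y \<noteq> 0"
      using S subspace_0 by blast
    then have "y /\<^sub>R norm y \<in> S \<inter> sphere 0 1"
      by (simp add: S(1) subspace_scale)
    then show ?thesis by blast
  qed
  moreover have "continuous_on (S \<inter> sphere 0 1) (\<lambda>x. x \<bullet> f x)"
    using f by (intro continuous_intros linear_continuous_on linear_conv_bounded_linear[THEN iffD1])
  \<comment> \<open>A maximiser of the quadratic form of \<open>f\<close> on the unit sphere of
    \<open>S\<close>; it will be the eigenvector, and the maximum \<open>c\<close> its
    eigenvalue.\<close>
  ultimately obtain x where x: "x \<in> S \<inter> sphere 0 1"
    and max: "\<And>y. y \<in> S \<inter> sphere 0 1 \<Longrightarrow> y \<bullet> f y \<le> x \<bullet> f x"
    using continuous_attains_sup[of "S \<inter> sphere 0 1" "\<lambda>x. x \<bullet> f x"] by blast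
  define c where "c = x \<bullet> f x"
  have xx: "x \<bullet> x = 1" using x by (simp add: norm_eq_1)
  have max': "z \<bullet> f z \<le> c * (z \<bullet> z)" if z: "z \<in> S" for z
  proof (cases "z = 0")
    case True then show ?thesis using f by (simp add: linear_0)
  next
    case False
    then have "z /\<^sub>R norm z \<in> S \<inter> sphere 0 1"
      using z by (simp add: S(1) subspace_scale)
    from max[OF this] have "(z \<bullet> f z) / (norm z)\<^sup>2 \<le> c"
      using f by (simp add: c_def linear_scale power2_eq_square field_simps)
    then show ?thesis
      using False by (simp add: field_simps dot_square_norm)
  qed
  \<comment> \<open>The residual \<open>y\<close> is a direction inside \<open>S\<close> orthogonal
    to \<open>x\<close>. Moving from \<open>x\<close> towards \<open>y\<close> gains
    \<open>2 * t * (y \<bullet> y)\<close> to first order, so a non-zero \<open>y\<close> would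
    contradict maximality.\<close>
  define y where "y = f x - c *\<^sub>R x"
  have yS: "y \<in> S"
    unfolding y_def using x S by (auto intro!: subspace_diff subspace_scale)
  have yx: "y \<bullet> x = 0"
    by (simp add: y_def inner_diff_left inner_diff_right c_def xx inner_commute)
  have yf: "y \<bullet> f x = y \<bullet> y"
    using yx by (simp add: y_def inner_diff_left inner_diff_right)
  have "y = 0"
  proof (rule ccontr)
    assume "y \<noteq> 0"
    then have pos: "y \<bullet> y > 0" by simp
    define K where "K = c * (y \<bullet> y) - y \<bullet> f y"
    \<comment> \<open>With this step the quadratic loss, divided by \<open>t\<close>, is at most
      \<open>y \<bullet> y\<close>, half of the linear gain; the summand 1 keeps the denominator
      positive.\<close>
    define t where "t = (y \<bullet> y) / (\<bar>K\<bar> + 1)"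
    have t: "t > 0" using pos by (simp add: t_def)
    have "(x + t *\<^sub>R y) \<bullet> f (x + t *\<^sub>R y) \<le> c * ((x + t *\<^sub>R y) \<bullet> (x + t *\<^sub>R y))"
      using x yS S(1) by (intro max' subspace_add subspace_scale) auto
    moreover have "(x + t *\<^sub>R y) \<bullet> f (x + t *\<^sub>R y) = c + 2 * t * (y \<bullet> y) + t * t * (y \<bullet> f y)"
      using f adj[of x y] yf
      by (simp add: linear_add linear_scale inner_add_left inner_add_right c_def inner_commute algebra_simps)
    moreover have "(x + t *\<^sub>R y) \<bullet> (x + t *\<^sub>R y) = 1 + t * t * (y \<bullet> y)"
      using yx by (simp add: inner_add_left inner_add_right xx inner_commute)
    ultimately have "c + 2 * t * (y \<bullet> y) + t * t * (y \<bullet> f y) \<le> c * (1 + t * t * (y \<bullet> y))"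
      by metis
    then have "t * (2 * (y \<bullet> y)) \<le> t * (t * K)"
      by (simp add: K_def algebra_simps)
    then have "2 * (y \<bullet> y) \<le> t * K" using t by simp
    also have "\<dots> \<le> t * (\<bar>K\<bar> + 1)" using t by (intro mult_left_mono) auto
    also have "\<dots> = y \<bullet> y" by (simp add: t_def add_nonneg_pos less_imp_neq[THEN not_sym])
    finally show False using pos by simp
  qed
  then show ?thesis using that[of x c] x by (simp add: y_def)
qed

theorem selfadjoint_orthonormal_eigenbasis:
  fixes f :: "'a::euclidean_space \<Rightarrow> 'a"
  assumes f: "linear f" and adj: "\<And>x y. f x \<bullet> y = x \<bullet> f y"
    and S: "subspace S" "f ` S \<subseteq> S"
  shows "\<exists>B. pairwise orthogonal B \<and> (\<forall>x\<in>B. norm x = 1 \<and> (\<exists>c. f x = c *\<^sub>R x)) \<and> span B = S"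
  using S
proof (induction "dim S" arbitrary: S rule: less_induct)
  case less
  show ?case
  proof (cases "S = {0}")
    case True
    then show ?thesis by (intro exI[of _ "{}"]) auto
  next
    case False
    obtain x c where x: "x \<in> S" "norm x = 1" "f x = c *\<^sub>R x"
      using selfadjoint_eigenvector[OF f adj less.prems False] by metis
    define T where "T = S \<inter> {y. x \<bullet> y = 0}"
    have T: "subspace T"
      unfolding T_def using less.prems(1)
      by (intro subspace_inter) (auto simp: subspace_hyperplane)
    have fT: "f ` T \<subseteq> T"
      using less.prems adj[of x, symmetric] x(3) by (auto simp: T_def)
    have "x \<bullet> x = 1" using x by (simp add: norm_eq_1)
    then have "x \<notin> T" by (simp add: T_def)
    moreover have "T \<subseteq> S" by (auto simp: T_def)
    ultimately have "T \<subset> S" using x(1) by blast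
    then have "span T \<subset> span S"
      using T less.prems(1) by (simp add: span_eq_iff[THEN iffD2])
    then have "dim T < dim S" by (rule dim_psubset)
    from less.hyps[OF this T fT] obtain B where B: "pairwise orthogonal B"
      "\<forall>x\<in>B. norm x = 1 \<and> (\<exists>c. f x = c *\<^sub>R x)" "span B = T" by blast
    have BT: "B \<subseteq> T" using B(3) span_superset by blast
    have "pairwise orthogonal (insert x B)"
      using B(1) BT by (auto simp: pairwise_insert orthogonal_def T_def inner_commute)
    moreover have "span (insert x B) = S"
    proof
      show "span (insert x B) \<subseteq> S"
        using BT x(1) less.prems(1) by (intro span_minimal) (auto simp: T_def)
      show "S \<subseteq> span (insert x B)"
      proof
        fix y assume y: "y \<in> S"
        have "y - (x \<bullet> y) *\<^sub>R x \<in> T"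
          using y x(1) less.prems(1) \<open>x \<bullet> x = 1\<close>
          by (auto simp: T_def inner_diff_right intro!: subspace_diff subspace_scale)
        then have "y - (x \<bullet> y) *\<^sub>R x \<in> span B" using B(3) by simp
        then show "y \<in> span (insert x B)"
          using span_breakdown_eq by blast
      qed
    qed
    ultimately show ?thesis
      using B(2) x by (intro exI[of _ "insert x B"]) auto
  qed
qed

text \<open>Indexing by \<open>'n\<close> itself fixes the number of vectors to the dimension, so a
  frame is automatically a basis.\<close>

definition orthonormal_frame :: "('n::finite \<Rightarrow> real^'n) \<Rightarrow> bool" where
  "orthonormal_frame v \<longleftrightarrow> (\<forall>i j. v i \<bullet> v j = (if i = j then 1 else 0))"

lemma orthonormal_frame_inner:
  "orthonormal_frame v \<Longrightarrow> v i \<bullet> v j = (if i = j then 1 else 0)"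
  by (simp add: orthonormal_frame_def)

lemma orthonormal_frame_norm: "orthonormal_frame v \<Longrightarrow> norm (v i) = 1"
  by (simp add: orthonormal_frame_def norm_eq_1)

lemma orthonormal_frame_expansion:
  fixes v :: "'n::finite \<Rightarrow> real^'n"
  assumes v: "orthonormal_frame v"
  shows "x = (\<Sum>j\<in>UNIV. (x \<bullet> v j) *\<^sub>R v j)"
proof -
  have inj: "inj v"
  proof (rule injI)
    fix i j assume "v i = v j"
    then show "i = j" using v unfolding orthonormal_frame_def by (metis zero_neq_one)
  qed
  have "independent (range v)"
  proof (rule pairwise_orthogonal_independent)
    show "pairwise orthogonal (range v)"
      using v by (auto simp: pairwise_def orthogonal_def orthonormal_frame_def)
    show "0 \<notin> range v"
      using orthonormal_frame_norm[OF v] by (metis norm_zero rangeE zero_neq_one)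
  qed
  moreover have "card (range v) = DIM(real^'n)"
    using inj by (simp add: card_image)
  ultimately have span: "span (range v) = UNIV"
    by (metis card_eq_dim dim_UNIV subset_UNIV order_refl top.extremum_uniqueI independent_bound_general span_subspace subspace_UNIV)
  define y where "y = x - (\<Sum>j\<in>UNIV. (x \<bullet> v j) *\<^sub>R v j)"
  have "orthogonal y z" if "z \<in> span (range v)" for z
  proof (rule orthogonal_to_span[OF that])
    fix z assume "z \<in> range v"
    then obtain i where z: "z = v i" by blast
    show "orthogonal y z"
      by (simp add: z y_def orthogonal_def inner_diff_left inner_sum_left orthonormal_frame_inner[OF v] if_distrib cong: if_cong)
  qed
  then have "y = 0" using span by (metis UNIV_I orthogonal_self)
  then show ?thesis by (simp add: y_def)
qed

lemma orthonormal_frame_norm_sq: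
  fixes v :: "'n::finite \<Rightarrow> real^'n"
  assumes v: "orthonormal_frame v"
  shows "(norm x)\<^sup>2 = (\<Sum>j\<in>UNIV. (x \<bullet> v j)\<^sup>2)"
proof -
  have "(norm x)\<^sup>2 = x \<bullet> (\<Sum>j\<in>UNIV. (x \<bullet> v j) *\<^sub>R v j)"
    using orthonormal_frame_expansion[OF v, of x] by (simp add: power2_norm_eq_inner)
  then show ?thesis by (simp add: inner_sum_right power2_eq_square)
qed

lemma orthonormal_frame_eqI:
  fixes v :: "'n::finite \<Rightarrow> real^'n"
  assumes v: "orthonormal_frame v" and "\<And>j. x \<bullet> v j = y \<bullet> v j"
  shows "x = y"
  using assms(2) orthonormal_frame_expansion[OF v, of x] orthonormal_frame_expansion[OF v, of y] by simp

lemma matrix_vector_mult_sum_right: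
  fixes A :: "real^'n^'m"
  shows "A *v (\<Sum>j\<in>J. x j) = (\<Sum>j\<in>J. A *v x j)"
  by (rule linear_sum) simp

lemma matrix_eq_on_frame:
  fixes A B :: "real^'n^'m"
  assumes v: "orthonormal_frame v" and eq: "\<And>j. A *v v j = B *v v j"
  shows "A = B"
proof -
  have "A *v x = B *v x" for x
    by (subst (1 2) orthonormal_frame_expansion[OF v, of x])
      (simp add: matrix_vector_mult_sum_right matrix_vector_mult_scaleR eq)
  then show ?thesis by (simp add: matrix_eq)
qed

lemma norm_matrix_sq: "(norm (A::real^'n^'m))\<^sup>2 = (\<Sum>i\<in>UNIV. \<Sum>j\<in>UNIV. (A $ i $ j)\<^sup>2)"
  unfolding power2_norm_eq_inner inner_vec_def by (simp add: power2_eq_square)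

lemma frob_metric_self: "frob_metric V V = (norm V)\<^sup>2"
  unfolding frob_metric_def trace_def matrix_matrix_mult_def transpose_def norm_matrix_sq
  by (simp add: power2_eq_square) (rule sum.swap)

text \<open>Parseval in each row, after which the double sum is read by columns. The speed of a
  matrix curve can thus be measured in a frame adapted to \<open>R\<close> instead of the standard
  one.\<close>

lemma norm_matrix_sq_frame:
  fixes A :: "real^'n^'m"
  assumes v: "orthonormal_frame v"
  shows "(norm A)\<^sup>2 = (\<Sum>j\<in>UNIV. (norm (A *v v j))\<^sup>2)"
proof -
  have "(norm A)\<^sup>2 = (\<Sum>i\<in>UNIV. (norm (A $ i))\<^sup>2)"
    unfolding power2_norm_eq_inner inner_vec_def by simp
  also have "\<dots> = (\<Sum>i\<in>UNIV. \<Sum>j\<in>UNIV. (A $ i \<bullet> v j)\<^sup>2)"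
    by (simp add: orthonormal_frame_norm_sq[OF v])
  also have "\<dots> = (\<Sum>j\<in>UNIV. \<Sum>i\<in>UNIV. ((A *v v j) $ i)\<^sup>2)"
    by (subst sum.swap) (simp add: matrix_vector_mul_component)
  finally show ?thesis
    unfolding power2_norm_eq_inner[of "A *v _"] inner_vec_def by (simp add: power2_eq_square)
qed

text \<open>A sum of rank-one matrices, column \<open>w j\<close> times row \<open>v j\<close>; for
  an orthonormal frame \<open>v\<close> it is the linear map sending each \<open>v j\<close> to
  \<open>w j\<close>.\<close>

definition frame_matrix :: "('n::finite \<Rightarrow> real^'n) \<Rightarrow> ('n \<Rightarrow> real^'m) \<Rightarrow> real^'n^'m" where
  "frame_matrix v w = (\<chi> r c. \<Sum>j\<in>UNIV. w j $ r * v j $ c)"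

lemma frame_matrix_mult: "frame_matrix v w *v x = (\<Sum>j\<in>UNIV. (v j \<bullet> x) *\<^sub>R w j)"
  by (simp add: vec_eq_iff frame_matrix_def matrix_vector_mult_def inner_vec_def sum_distrib_right sum_distrib_left)
     (subst sum.swap, simp add: mult_ac)

lemma frame_matrix_apply:
  assumes v: "orthonormal_frame v"
  shows "frame_matrix v w *v v j = w j"
  using v by (simp add: frame_matrix_mult orthonormal_frame_def if_distrib[of "\<lambda>c. c *\<^sub>R _"] cong: if_cong)

lemma inner_matrix_transpose: "x \<bullet> ((A::real^'n^'m) *v y) = (transpose A *v x) \<bullet> y"
  by (simp add: dot_lmul_matrix)

lemma transpose_eq_on_frame:
  fixes A B :: "real^'n^'n"
  assumes v: "orthonormal_frame v"
    and eq: "\<And>i j. v i \<bullet> (A *v v j) = (B *v v i) \<bullet> v j"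
  shows "transpose A = B"
proof (rule matrix_eq_on_frame[OF v])
  fix i show "transpose A *v v i = B *v v i"
    by (rule orthonormal_frame_eqI[OF v]) (use eq[of i] in \<open>simp add: inner_matrix_transpose\<close>)
qed

theorem symmetric_matrix_eigenframe:
  fixes M :: "real^'n^'n"
  assumes "transpose M = M"
  obtains v :: "'n \<Rightarrow> real^'n" and d :: "'n \<Rightarrow> real"
    where "orthonormal_frame v" "\<And>j. M *v v j = d j *\<^sub>R v j"
proof -
  have "(M *v x) \<bullet> y = x \<bullet> (M *v y)" for x y
    by (metis assms inner_matrix_transpose)
  then obtain B where B: "pairwise orthogonal B"
      "\<And>x. x \<in> B \<Longrightarrow> norm x = 1 \<and> (\<exists>c. M *v x = c *\<^sub>R x)" "span B = UNIV"
    using selfadjoint_orthonormal_eigenbasis[of "(*v) M" UNIV] by auto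
  have "independent B"
    using B(1,2) by (intro pairwise_orthogonal_independent) force+
  then have "card B = CARD('n)" "finite B"
    using B(3) dim_eq_card[of B UNIV] independent_imp_finite by auto
  then obtain v where v: "bij_betw v (UNIV :: 'n set) B"
    by (metis finite_class.finite_UNIV finite_same_card_bij)
  have vB: "v j \<in> B" for j using v by (auto simp: bij_betw_def)
  have "orthonormal_frame v"
    unfolding orthonormal_frame_def
  proof (intro allI)
    fix i j
    show "v i \<bullet> v j = (if i = j then 1 else 0)"
    proof (cases "i = j")
      case True
      then show ?thesis using B(2)[OF vB] by (simp add: norm_eq_1)
    next
      case False
      then have "v i \<noteq> v j" using v by (auto simp: bij_betw_def inj_on_def)
      then show ?thesis using B(1) vB False by (auto simp: pairwise_def orthogonal_def)
    qed
  qed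
  moreover obtain d where "\<And>j. M *v v j = d j *\<^sub>R v j"
    using B(2)[OF vB] by metis
  ultimately show ?thesis using that by blast
qed

text \<open>A left orthogonal factor cancels in \<open>transpose A ** A\<close>. Together with the
  version for right factors this is the bi-invariance of the metric, which gives geodesic arcs the
  constant speed \<open>norm B\<close>.\<close>

lemma norm_orthogonal_mult:
  fixes A :: "real^'n^'n"
  assumes "orthogonal_matrix P"
  shows "norm (P ** A) = norm A"
proof -
  have "frob_metric (P ** A) (P ** A) = frob_metric A A"
    unfolding frob_metric_def matrix_transpose_mul
    using assms by (metis matrix_mul_assoc matrix_mul_lid orthogonal_matrix_def)
  then show ?thesis by (simp add: frob_metric_self)
qed

text \<open>A right factor cancels in \<open>A ** transpose A\<close>, and cyclicity of the trace
  exchanges the two products.\<close>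

lemma norm_mult_orthogonal:
  fixes A :: "real^'n^'n"
  assumes "orthogonal_matrix P"
  shows "norm (A ** P) = norm A"
proof -
  have "trace (transpose (A ** P) ** (A ** P)) = trace ((A ** P) ** transpose (A ** P))"
    by (rule trace_mul_sym)
  also have "(A ** P) ** transpose (A ** P) = A ** transpose A"
    unfolding matrix_transpose_mul
    using assms by (metis matrix_mul_assoc matrix_mul_rid orthogonal_matrix_def)
  also have "trace (A ** transpose A) = trace (transpose A ** A)"
    by (rule trace_mul_sym)
  finally have "frob_metric (A ** P) (A ** P) = frob_metric A A"
    by (simp add: frob_metric_def)
  then show ?thesis by (simp add: frob_metric_self)
qed

section \<open>Eigenvalues of orthogonal matrices\<close>

lemma poly_det:
  fixes A :: "('a::comm_ring_1 poly)^'n^'n"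
  shows "poly (det A) z = det (\<chi> i j. poly (A $ i $ j) z)"
  by (simp add: det_def poly_sum poly_prod of_int_poly poly_mult)

lemma poly_charpoly: "poly (charpoly A) z = det (mat z - A)"
  unfolding charpoly_def poly_det
  by (rule arg_cong[of _ _ det]) (simp add: vec_eq_iff mat_def)

lemma matrix_mult_add_left:
  fixes A B :: "'a::semiring_1^'n^'m"
  shows "(A + B) ** C = A ** C + B ** C"
proof -
  have "((A + B) ** C) $ i $ j = (A ** C + B ** C) $ i $ j" for i j
    by (simp add: matrix_matrix_mult_def sum.distrib distrib_right)
  then show ?thesis unfolding vec_eq_iff by blast
qed

lemma matrix_mult_diff_left:
  fixes A B :: "'a::ring_1^'n^'m"
  shows "(A - B) ** C = A ** C - B ** C"
  by (simp add: vec_eq_iff matrix_matrix_mult_def sum_subtractf left_diff_distrib)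

lemma matrix_mult_diff_right:
  fixes A :: "'a::ring_1^'n^'m"
  shows "A ** (B - C) = A ** B - A ** C"
  by (simp add: vec_eq_iff matrix_matrix_mult_def sum_subtractf right_diff_distrib)

lemma mat_mult_entry:
  fixes A :: "'a::semiring_1^'n^'m"
  shows "(mat z ** A) $ i $ j = z * A $ i $ j" and "(A ** mat z) $ i $ j = A $ i $ j * z"
  by (simp_all add: matrix_matrix_mult_def mat_def if_distrib if_distribR cong: if_cong)

lemma complexify_mult: "complexify (A ** B) = complexify A ** complexify B"
  by (simp add: complexify_def vec_eq_iff matrix_matrix_mult_def)

lemma complexify_transpose: "complexify (transpose A) = transpose (complexify A)"
  by (simp add: complexify_def vec_eq_iff transpose_def)

lemma complexify_add: "complexify (A + B) = complexify A + complexify B"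
  by (simp add: complexify_def vec_eq_iff)

lemma complexify_mat: "complexify (mat r) = mat (of_real r)"
  by (simp add: complexify_def vec_eq_iff mat_def)

definition frame_cols :: "('n::finite \<Rightarrow> real^'n) \<Rightarrow> real^'n^'n" where
  "frame_cols v = (\<chi> r c. v c $ r)"

lemma orthogonal_frame_cols:
  assumes "orthonormal_frame v" shows "orthogonal_matrix (frame_cols v)"
  using assms unfolding orthogonal_matrix frame_cols_def orthonormal_frame_def
  by (simp add: vec_eq_iff matrix_matrix_mult_def transpose_def inner_vec_def mat_def)

lemma mult_frame_cols: "A ** frame_cols v = frame_cols (\<lambda>j. A *v v j)"
  by (simp add: vec_eq_iff frame_cols_def matrix_matrix_mult_def matrix_vector_mult_def)

lemma charpoly_transpose: "charpoly (transpose A) = charpoly A"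
proof -
  have "poly (charpoly (transpose A)) z = poly (charpoly A) z" for z
  proof -
    have "mat z - transpose A = transpose (mat z - A)"
      by (simp add: vec_eq_iff transpose_def mat_def)
    then show ?thesis by (simp add: poly_charpoly)
  qed
  then show ?thesis using poly_eq_poly_eq_iff by blast
qed

text \<open>Evaluation at every complex \<open>z\<close> turns this into an identity of
  determinants. A matrix and its transpose have the same characteristic polynomial, whence the
  square on the left; multiplicities are carried along without any eigenvector of
  \<open>R\<close>.\<close>

lemma charpoly_orthogonal_square:
  fixes R :: "real^'n^'n"
  assumes R: "orthogonal_matrix R" and v: "orthonormal_frame v"
    and M: "\<And>j. (R + transpose R) *v v j = (2 * d j) *\<^sub>R v j"
  shows "(charpoly (complexify R))\<^sup>2 = (\<Prod>j\<in>UNIV. [:1, - 2 * of_real (d j), 1:])"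
proof -
  define P where "P = complexify (frame_cols v)"
  have PP: "transpose P ** P = mat 1"
    using orthogonal_frame_cols[OF v]
    by (simp add: P_def orthogonal_matrix complexify_transpose[symmetric] complexify_mult[symmetric] complexify_mat)
  then have detP: "det (transpose P) * det P = 1"
    by (metis det_I det_mul)
  have RR: "complexify R ** transpose (complexify R) = mat 1"
    using R by (simp add: orthogonal_matrix_def complexify_transpose[symmetric] complexify_mult[symmetric] complexify_mat)
  have "poly ((charpoly (complexify R))\<^sup>2) z = poly (\<Prod>j\<in>UNIV. [:1, - 2 * of_real (d j), 1:]) z" for z
  proof -
    let ?C = "complexify R"
    define N where "N = (mat z - ?C) ** (mat z - transpose ?C)"
    have N: "N = mat (z\<^sup>2 + 1) - mat z ** complexify (R + transpose R)"
    proof -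
      have "N = mat z ** mat z - mat z ** transpose ?C - ?C ** mat z + ?C ** transpose ?C"
        by (simp add: N_def matrix_mult_diff_left matrix_mult_diff_right algebra_simps)
      also have "?C ** mat z = mat z ** ?C"
        by (simp add: vec_eq_iff mat_mult_entry mult.commute)
      finally show ?thesis
        unfolding RR complexify_add complexify_transpose
        by (simp add: vec_eq_iff mat_mult_entry) (simp add: mat_def power2_eq_square distrib_left)
    qed
    \<comment> \<open>\<open>D\<close> is \<open>N\<close> expressed in the frame. Comparing
      determinants in \<open>N ** P = P ** D\<close> avoids inverting \<open>P\<close>.\<close>
    define D :: "complex^'n^'n" where "D = (\<chi> i j. if i = j then z\<^sup>2 + 1 - z * (2 * of_real (d j)) else 0)"
    have "complexify (R + transpose R) ** P = complexify (frame_cols (\<lambda>j. (2 * d j) *\<^sub>R v j))"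
      by (simp add: P_def complexify_mult[symmetric] mult_frame_cols M)
    also have "\<dots> = P ** (\<chi> i j. if i = j then 2 * of_real (d j) else 0)"
      by (simp add: vec_eq_iff P_def complexify_def frame_cols_def matrix_matrix_mult_def if_distrib mult.commute cong: if_cong)
    finally have MP: "complexify (R + transpose R) ** P = \<dots>" .
    have "N ** P = mat (z\<^sup>2 + 1) ** P - mat z ** (complexify (R + transpose R) ** P)"
      by (simp add: N matrix_mult_diff_left matrix_mul_assoc)
    also have "\<dots> = P ** D"
      unfolding MP
      by (simp add: vec_eq_iff mat_mult_entry)
        (simp add: D_def matrix_matrix_mult_def if_distrib right_diff_distrib mult_ac cong: if_cong)
    finally have "det N * det P = det P * det D" by (metis det_mul)
    moreover have "det P \<noteq> 0" using detP by auto
    ultimately have "det N = det D" by simp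
    also have "det D = (\<Prod>j\<in>UNIV. z\<^sup>2 + 1 - z * (2 * of_real (d j)))"
      by (subst det_diagonal) (simp_all add: D_def)
    finally have "det N = \<dots>" .
    moreover have "det N = poly (charpoly ?C) z * poly (charpoly (transpose ?C)) z"
      by (simp add: N_def det_mul poly_charpoly)
    ultimately show ?thesis
      by (simp add: charpoly_transpose poly_prod power2_eq_square algebra_simps)
  qed
  then show ?thesis using poly_eq_poly_eq_iff by blast
qed

text \<open>The strip of the principal branch contains the argument \<open>pi\<close> but not
  \<open>- pi\<close>, so the latter has to be replaced by \<open>pi\<close>; the modulus does not
  notice.\<close>

lemma norm_Ln_cis:
  assumes "\<theta> \<in> {0..pi}"
  shows "cmod (Ln (cis \<theta>)) = \<theta>" and "cmod (Ln (cis (-\<theta>))) = \<theta>"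
proof -
  have 1: "Ln (cis \<theta>) = \<i> * \<theta>"
    unfolding cis_conv_exp using assms pi_gt_zero by (subst Ln_exp) (auto simp: mult.commute simp del: pi_gt_zero)
  then show "cmod (Ln (cis \<theta>)) = \<theta>" using assms by (simp add: norm_mult)
  show "cmod (Ln (cis (-\<theta>))) = \<theta>"
  proof (cases "\<theta> = pi")
    case True
    then have "cis (-\<theta>) = cis \<theta>" by (simp add: complex_eq_iff)
    then show ?thesis using 1 assms by (simp add: norm_mult)
  next
    case False
    then have "Ln (cis (-\<theta>)) = \<i> * of_real (-\<theta>)"
      unfolding cis_conv_exp using assms by (subst Ln_exp) (auto simp: mult.commute)
    then show ?thesis using assms by (simp add: norm_mult)
  qed
qed

text \<open>Each quadratic factor splits into a conjugate pair whose logarithms have equal modulus,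
  so the sum over the doubled multiset of eigenvalues can be halved. The frame is arbitrary, which
  allows two frames of the same \<open>R\<close> to be compared.\<close>

theorem sum_Ln_eigenvalues:
  fixes R :: "real^'n^'n"
  assumes R: "orthogonal_matrix R" and v: "orthonormal_frame v"
    and M: "\<And>j. (R + transpose R) *v v j = (2 * cos (\<theta> j)) *\<^sub>R v j"
    and \<theta>: "\<And>j. \<theta> j \<in> {0..pi}"
  shows "(\<Sum>\<mu>\<in>#eigenvalues (complexify R). (cmod (Ln \<mu>))\<^sup>2) = (\<Sum>j\<in>UNIV. (\<theta> j)\<^sup>2)"
proof -
  define q where "q j = [:1, - 2 * complex_of_real (cos (\<theta> j)), 1:]" for j
  have q: "q j = [:- cis (\<theta> j), 1:] * [:- cis (- \<theta> j), 1:]" for j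
    by (simp add: q_def complex_eq_iff power2_eq_square[symmetric])
  let ?c = "charpoly (complexify R)"
  have sq: "?c * ?c = (\<Prod>j\<in>UNIV. q j)"
    using charpoly_orthogonal_square[OF R v M] by (simp add: q_def power2_eq_square)
  have q0: "q j \<noteq> 0" for j by (simp add: q_def)
  then have "?c \<noteq> 0" using sq by auto
  then have "eigenvalues (complexify R) + eigenvalues (complexify R) = (\<Sum>j\<in>UNIV. proots (q j))"
    unfolding eigenvalues_def using sq q0 by (simp add: proots_mult[symmetric] proots_prod)
  also have "\<dots> = (\<Sum>j\<in>UNIV. {#cis (\<theta> j), cis (- \<theta> j)#})"
    unfolding q by (intro sum.cong refl) (subst proots_mult, simp_all)
  finally have ev: "eigenvalues (complexify R) + eigenvalues (complexify R) = \<dots>" .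
  let ?f = "\<lambda>A. (\<Sum>\<mu>\<in>#A. (cmod (Ln \<mu>))\<^sup>2)"
  have add: "?f (\<Sum>j\<in>J. A j) = (\<Sum>j\<in>J. ?f (A j))" for J :: "'n set" and A
    by (induction J rule: infinite_finite_induct) auto
  have "?f (eigenvalues (complexify R)) + ?f (eigenvalues (complexify R))
      = ?f (eigenvalues (complexify R) + eigenvalues (complexify R))" by simp
  also have "\<dots> = (\<Sum>j\<in>UNIV. ?f {#cis (\<theta> j), cis (- \<theta> j)#})"
    unfolding ev by (rule add)
  also have "\<dots> = (\<Sum>j\<in>UNIV. 2 * (\<theta> j)\<^sup>2)"
    using norm_Ln_cis[OF \<theta>] by simp
  finally show ?thesis by (simp add: sum_distrib_left[symmetric])
qed

section \<open>The matrix exponential\<close>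

lemma matrix_sumsI:
  fixes f :: "nat \<Rightarrow> real^'n^'m"
  assumes "\<And>i j. (\<lambda>k. f k $ i $ j) sums (S $ i $ j)"
  shows "f sums S"
  using assms unfolding sums_def by (intro vec_tendstoI) simp

lemma vec_has_vector_derivativeI:
  fixes f :: "real \<Rightarrow> 'a::euclidean_space^'n"
  assumes "\<And>i. ((\<lambda>t. f t $ i) has_vector_derivative D $ i) F"
  shows "(f has_vector_derivative D) F"
proof -
  have lin: "bounded_linear (axis i :: 'a \<Rightarrow> 'a^'n)" for i
    by (intro linear_conv_bounded_linear[THEN iffD1] linearI) (simp_all add: vec_eq_iff axis_def)
  have expand: "(\<Sum>i\<in>UNIV. axis i (x $ i)) = x" for x :: "'a^'n"
    by (simp add: vec_eq_iff axis_def)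
  have "((\<lambda>t. \<Sum>i\<in>UNIV. axis i (f t $ i)) has_vector_derivative (\<Sum>i\<in>UNIV. axis i (D $ i))) F"
    by (intro has_vector_derivative_sum bounded_linear.has_vector_derivative[OF lin] assms)
  then show ?thesis by (simp only: expand)
qed

lemma matpow_0: "matpow B 0 = mat 1"
  by (simp add: matpow_def)

lemma matpow_Suc: "matpow B (Suc k) = B ** matpow B k"
  by (simp add: matpow_def)

lemma matpow_scale: "matpow (t *\<^sub>R B) k = t ^ k *\<^sub>R matpow B k"
proof (induction k)
  case (Suc k)
  have "matpow (t *\<^sub>R B) (Suc k) = (t *\<^sub>R B) ** (t ^ k *\<^sub>R matpow B k)"
    by (simp add: matpow_Suc Suc)
  also have "\<dots> = (t * t ^ k) *\<^sub>R (B ** matpow B k)"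
    by (simp add: vec_eq_iff matrix_matrix_mult_def sum_distrib_left mult_ac)
  finally show ?case by (simp add: matpow_Suc)
qed (simp add: matpow_0)

lemma matpow_entry_bound:
  fixes B :: "real^'n^'n"
  shows "\<bar>matpow B k $ i $ j\<bar> \<le> (\<Sum>i\<in>UNIV. \<Sum>j\<in>UNIV. \<bar>B $ i $ j\<bar>) ^ k"
proof (induction k arbitrary: i j)
  case 0
  show ?case by (simp add: matpow_0 mat_def)
next
  case (Suc k)
  let ?b = "\<Sum>i\<in>UNIV. \<Sum>j\<in>UNIV. \<bar>B $ i $ j\<bar>"
  have "\<bar>matpow B (Suc k) $ i $ j\<bar> \<le> (\<Sum>l\<in>UNIV. \<bar>B $ i $ l\<bar> * \<bar>matpow B k $ l $ j\<bar>)"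
    unfolding matpow_Suc matrix_matrix_mult_def
    by (simp add: abs_mult[symmetric] sum_abs)
  also have "\<dots> \<le> (\<Sum>l\<in>UNIV. \<bar>B $ i $ l\<bar> * ?b ^ k)"
    by (intro sum_mono mult_left_mono Suc) auto
  also have "\<dots> = (\<Sum>l\<in>UNIV. \<bar>B $ i $ l\<bar>) * ?b ^ k"
    by (simp add: sum_distrib_right)
  also have "\<dots> \<le> ?b * ?b ^ k"
    by (intro mult_right_mono member_le_sum[where f="\<lambda>i. \<Sum>l\<in>UNIV. \<bar>B $ i $ l\<bar>"] zero_le_power sum_nonneg) auto
  finally show ?case by simp
qed

lemma summable_matpow_entry:
  fixes B :: "real^'n^'n"
  shows "summable (\<lambda>k. (matpow B k $ i $ j / fact k) * t ^ k)"
proof (rule summable_comparison_test')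
  let ?b = "\<Sum>i\<in>UNIV. \<Sum>j\<in>UNIV. \<bar>B $ i $ j\<bar>"
  show "summable (\<lambda>k. (?b * \<bar>t\<bar>) ^ k / fact k)"
    using summable_exp[of "?b * \<bar>t\<bar>"] by (simp add: field_simps)
  show "norm ((matpow B k $ i $ j / fact k) * t ^ k) \<le> (?b * \<bar>t\<bar>) ^ k / fact k" if "0 \<le> k" for k
    using matpow_entry_bound[of B k i j]
    by (simp add: abs_mult power_abs power_mult_distrib divide_right_mono mult_right_mono)
qed

text \<open>Along the line \<open>t *\<^sub>R B\<close> each entry of the exponential is a scalar
  power series in \<open>t\<close> that converges everywhere, which opens the way to scalar termwise
  differentiation.\<close>

lemma mexp_entry_sums:
  fixes B :: "real^'n^'n"
  shows "(\<lambda>k. (matpow B k $ i $ j / fact k) * t ^ k) sums (mexp (t *\<^sub>R B) $ i $ j)"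
proof -
  define S where "S = (\<chi> i j. \<Sum>k. (matpow B k $ i $ j / fact k) * t ^ k)"
  have S: "(\<lambda>k. (matpow B k $ i $ j / fact k) * t ^ k) sums (S $ i $ j)" for i j
    unfolding S_def vec_lambda_beta by (rule summable_sums[OF summable_matpow_entry])
  have "(\<lambda>k. matpow (t *\<^sub>R B) k /\<^sub>R fact k) sums S"
    by (rule matrix_sumsI) (use S in \<open>simp add: matpow_scale divide_inverse mult_ac\<close>)
  then have "mexp (t *\<^sub>R B) = S"
    by (simp add: mexp_def sums_iff)
  then show ?thesis using S by simp
qed

lemma mexp_0: "mexp 0 = (mat 1 :: real^'n^'n)"
proof -
  have "mexp (0 :: real^'n^'n) $ i $ j = mat 1 $ i $ j" for i j
  proof -
    have "(\<lambda>k. (matpow (0::real^'n^'n) k $ i $ j / fact k) * 0 ^ k) sums (matpow (0::real^'n^'n) 0 $ i $ j / fact 0)"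
      using sums_finite[of "{0}" "\<lambda>k. (matpow (0::real^'n^'n) k $ i $ j / fact k) * 0 ^ k"] by simp
    with mexp_entry_sums[of "0::real^'n^'n" i j 0] show ?thesis
      by (auto simp: matpow_0 dest: sums_unique2)
  qed
  then show ?thesis by (simp add: vec_eq_iff)
qed

theorem mexp_has_vector_derivative:
  fixes B :: "real^'n^'n"
  shows "((\<lambda>t. mexp (t *\<^sub>R B)) has_vector_derivative (B ** mexp (t *\<^sub>R B))) (at t within S)"
proof (rule has_vector_derivative_at_within, (rule vec_has_vector_derivativeI)+,
    unfold has_real_derivative_iff_has_vector_derivative[symmetric])
  fix i j
  define c where "c k = matpow B k $ i $ j / fact k" for k
  have "((\<lambda>t. \<Sum>k. c k * t ^ k) has_real_derivative (\<Sum>k. diffs c k * t ^ k)) (at t)"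
    unfolding c_def by (rule termdiffs_strong_converges_everywhere) (rule summable_matpow_entry)
  moreover have "(\<lambda>t. \<Sum>k. c k * t ^ k) = (\<lambda>t. mexp (t *\<^sub>R B) $ i $ j)"
    using mexp_entry_sums[of B i j] by (auto simp: c_def sums_iff)
  moreover have "(\<Sum>k. diffs c k * t ^ k) = (B ** mexp (t *\<^sub>R B)) $ i $ j"
  proof -
    have "(\<lambda>k. \<Sum>l\<in>UNIV. B $ i $ l * ((matpow B k $ l $ j / fact k) * t ^ k)) sums
        (\<Sum>l\<in>UNIV. B $ i $ l * (mexp (t *\<^sub>R B) $ l $ j))"
      by (intro sums_sum sums_mult mexp_entry_sums)
    moreover have "(\<Sum>l\<in>UNIV. B $ i $ l * ((matpow B k $ l $ j / fact k) * t ^ k)) = diffs c k * t ^ k" for k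
    proof -
      \<comment> \<open>The factor \<open>Suc k\<close> from \<open>diffs\<close> cancels in
        \<open>fact (Suc k)\<close>, and \<open>matpow B (Suc k)\<close> releases one factor
        \<open>B\<close>.\<close>
      have "diffs c k = (\<Sum>l\<in>UNIV. B $ i $ l * matpow B k $ l $ j) / fact k"
        by (simp add: diffs_def c_def matpow_Suc matrix_matrix_mult_def field_simps del: of_nat_Suc)
      then show ?thesis by (simp add: sum_divide_distrib sum_distrib_left mult_ac)
    qed
    ultimately show ?thesis by (simp add: sums_iff matrix_matrix_mult_def)
  qed
  ultimately show "((\<lambda>t. mexp (t *\<^sub>R B) $ i $ j) has_real_derivative (B ** mexp (t *\<^sub>R B)) $ i $ j) (at t)"
    by simp
qed

lemma bounded_linear_matrix_apply: "bounded_linear (\<lambda>A. (A::real^'n^'m) *v x)"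
  by (intro linear_conv_bounded_linear[THEN iffD1] linearI)
    (simp_all add: matrix_vector_mult_add_rdistrib scaleR_matrix_vector_assoc)

lemma bounded_linear_matrix_mult_left: "bounded_linear (\<lambda>A. (C::real^'n^'m) ** (A::real^'k^'n))"
proof (intro linear_conv_bounded_linear[THEN iffD1] linearI)
  show "C ** (A + B) = C ** A + C ** B" for A B :: "real^'k^'n"
    by (rule matrix_add_ldistrib)
  show "C ** (r *\<^sub>R A) = r *\<^sub>R (C ** A)" for r and A :: "real^'k^'n"
    by (simp add: vec_eq_iff matrix_matrix_mult_def sum_distrib_left mult.left_commute)
qed

lemma skew_inner: "transpose B = - B \<Longrightarrow> x \<bullet> ((B::real^'n^'n) *v y) = - ((B *v x) \<bullet> y)"
proof -
  assume "transpose B = - B"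
  moreover have "(- B) *v x = - (B *v x)"
    by (simp add: vec_eq_iff matrix_vector_mult_def sum_negf)
  ultimately show ?thesis unfolding inner_matrix_transpose by simp
qed

lemma skew_inner_self: "transpose B = - B \<Longrightarrow> x \<bullet> ((B::real^'n^'n) *v x) = 0"
  using skew_inner[of B x x] by (simp add: inner_commute)

text \<open>Skewness makes the velocity orthogonal to the position. Applied to a single solution
  this yields orthogonality of the exponential; applied to a difference of solutions it yields
  uniqueness.\<close>

lemma skew_flow_norm:
  fixes B :: "real^'n^'n"
  assumes B: "transpose B = - B"
    and z: "\<And>t. (z has_vector_derivative (B *v z t)) (at t)"
  shows "norm (z t) = norm (z 0)"
proof -
  have "((\<lambda>t. z t \<bullet> z t) has_real_derivative 0) (at t)" for t
  proof -
    have "((\<lambda>t. z t \<bullet> z t) has_vector_derivative (z t \<bullet> (B *v z t) + (B *v z t) \<bullet> z t)) (at t)"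
      by (rule bounded_bilinear.has_vector_derivative[OF bounded_bilinear_inner z z])
    then show ?thesis
      using skew_inner_self[OF B] by (simp add: has_real_derivative_iff_has_vector_derivative inner_commute)
  qed
  then have "z t \<bullet> z t = z 0 \<bullet> z 0"
    using DERIV_isconst_all[of "\<lambda>t. z t \<bullet> z t" t 0] by blast
  then show ?thesis by (simp add: norm_eq_sqrt_inner)
qed

lemma mexp_apply_has_vector_derivative:
  "((\<lambda>t. mexp (t *\<^sub>R B) *v x) has_vector_derivative (B *v (mexp (t *\<^sub>R B) *v x))) (at t)"
  unfolding matrix_vector_mul_assoc
  by (rule bounded_linear.has_vector_derivative[OF bounded_linear_matrix_apply mexp_has_vector_derivative])

lemma norm_preserving_orthogonal_matrix:
  fixes A :: "real^'n^'n"
  assumes "\<And>x. norm (A *v x) = norm x"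
  shows "orthogonal_matrix A"
proof -
  have "orthogonal_transformation ((*v) A)"
    using assms by (simp add: orthogonal_transformation)
  then show ?thesis by (simp add: orthogonal_transformation_matrix)
qed

lemma orthogonal_mexp:
  assumes B: "transpose B = - B"
  shows "orthogonal_matrix (mexp (t *\<^sub>R B))"
  by (rule norm_preserving_orthogonal_matrix)
    (use skew_flow_norm[OF B mexp_apply_has_vector_derivative, where t=t] in \<open>simp add: mexp_0\<close>)

text \<open>The spectral data of a skew matrix in real form: \<open>v\<close> is an eigenframe of
  the symmetric matrix \<open>B ** B\<close>, and the \<open>\<theta> j\<close> are the moduli of
  the eigenvalues of \<open>B\<close>. The frame need not be paired into invariant planes.\<close>

definition skew_spectrum :: "real^'n^'n \<Rightarrow> ('n \<Rightarrow> real^'n) \<Rightarrow> ('n \<Rightarrow> real) \<Rightarrow> bool" where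
  "skew_spectrum B v \<theta> \<longleftrightarrow> transpose B = - B \<and> orthonormal_frame v \<and>
     (\<forall>j. 0 \<le> \<theta> j \<and> B *v (B *v v j) = - (\<theta> j)\<^sup>2 *\<^sub>R v j)"

lemma skew_spectrum_norm:
  assumes "skew_spectrum B v \<theta>"
  shows "norm (B *v v j) = \<theta> j"
proof -
  have "(B *v v j) \<bullet> (B *v v j) = (\<theta> j)\<^sup>2"
    using assms by (subst skew_inner) (auto simp: skew_spectrum_def orthonormal_frame_def)
  then show ?thesis
    using assms by (simp add: norm_eq_sqrt_inner skew_spectrum_def)
qed

lemma skew_spectrum_norm_matrix:
  assumes "skew_spectrum B v \<theta>"
  shows "norm B = sqrt (\<Sum>j\<in>UNIV. (\<theta> j)\<^sup>2)"
proof -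
  have "(norm B)\<^sup>2 = (\<Sum>j\<in>UNIV. (\<theta> j)\<^sup>2)"
    using assms by (simp add: norm_matrix_sq_frame[of v] skew_spectrum_def skew_spectrum_norm[OF assms])
  then show ?thesis by (metis norm_ge_zero real_sqrt_unique)
qed

text \<open>For \<open>\<theta> j = 0\<close> the vector \<open>B *v v j\<close> vanishes, so the value of \<open>sin 0 / 0\<close> is immaterial.\<close>

theorem mexp_skew_spectrum:
  assumes B: "skew_spectrum B v \<theta>"
  shows "mexp (t *\<^sub>R B) *v v j = cos (t * \<theta> j) *\<^sub>R v j + (sin (t * \<theta> j) / \<theta> j) *\<^sub>R (B *v v j)"
proof -
  define y where "y t = cos (t * \<theta> j) *\<^sub>R v j + (sin (t * \<theta> j) / \<theta> j) *\<^sub>R (B *v v j)" for t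
  \<comment> \<open>Both sides solve the linear equation with generator \<open>B\<close> and start
    at \<open>v j\<close>, so their difference \<open>z\<close> keeps the norm
    \<open>0\<close>.\<close>
  define z where "z t = mexp (t *\<^sub>R B) *v v j - y t" for t
  have skew: "transpose B = - B" and BB: "B *v (B *v v j) = - (\<theta> j)\<^sup>2 *\<^sub>R v j"
    using B by (auto simp: skew_spectrum_def)
  have B0: "B *v v j = 0" if "\<theta> j = 0"
    using skew_spectrum_norm[OF B, of j] that by simp
  have "(y has_vector_derivative (B *v y t)) (at t)" for t
  proof -
    have "(y has_vector_derivative ((- sin (t * \<theta> j) * \<theta> j) *\<^sub>R v j + (cos (t * \<theta> j) * \<theta> j / \<theta> j) *\<^sub>R (B *v v j))) (at t)"
      unfolding y_def
      by (intro has_vector_derivative_add bounded_linear.has_vector_derivative[OF bounded_linear_scaleR_left])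
        (auto intro!: derivative_eq_intros simp: has_real_derivative_iff_has_vector_derivative[symmetric])
    moreover have "(- sin (t * \<theta> j) * \<theta> j) *\<^sub>R v j + (cos (t * \<theta> j) * \<theta> j / \<theta> j) *\<^sub>R (B *v v j) = B *v y t"
      using B0 by (cases "\<theta> j = 0")
        (simp_all add: y_def matrix_vector_right_distrib matrix_vector_mult_scaleR BB power2_eq_square)
    ultimately show ?thesis by simp
  qed
  then have "(z has_vector_derivative (B *v z t)) (at t)" for t
    unfolding z_def matrix_vector_mult_diff_distrib
    by (rule has_vector_derivative_diff[OF mexp_apply_has_vector_derivative])
  from skew_flow_norm[OF skew this, of t] have "z t = 0"
    by (simp add: z_def y_def mexp_0)
  then show ?thesis by (simp add: z_def y_def)
qed

section \<open>Arc length\<close>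

text \<open>One-sided derivatives differ from two-sided ones only at the end points, a null set. The
  integrand then no longer depends on the interval, as additivity requires.\<close>

lemma arc_length_eq:
  "arc_length \<gamma> a b = integral {a..b} (\<lambda>t. norm (vector_derivative \<gamma> (at t)))"
  unfolding arc_length_def Let_def frob_metric_self
proof (rule integral_spike[of "{a, b}"])
  fix t assume "t \<in> {a..b} - {a, b}"
  then have "at t within {a..b} = at t" by (intro at_within_Icc_at) auto
  then show "norm (vector_derivative \<gamma> (at t)) = sqrt ((norm (vector_derivative \<gamma> (at t within {a..b})))\<^sup>2)"
    by simp
qed simp

text \<open>What the fundamental theorem of calculus with finitely many exceptions asks for, and
  integrable speed. These properties pass to subintervals and concatenations without tracking break
  points.\<close>

definition tame_curve :: "(real \<Rightarrow> 'a::euclidean_space) \<Rightarrow> real \<Rightarrow> real \<Rightarrow> bool" where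
  "tame_curve f a b \<longleftrightarrow> continuous_on {a..b} f \<and>
     (\<exists>S. finite S \<and> (\<forall>t\<in>{a<..<b} - S. f differentiable (at t))) \<and>
     (\<lambda>t. norm (vector_derivative f (at t))) integrable_on {a..b}"

lemma C1_on_interval_vector_derivative:
  assumes "\<And>t. t \<in> {a..b} \<Longrightarrow> (f has_vector_derivative f' t) (at t within {a..b})" and "t \<in> {a<..<b}"
  shows "(f has_vector_derivative f' t) (at t)" and "vector_derivative f (at t) = f' t"
proof -
  show *: "(f has_vector_derivative f' t) (at t)"
    using assms(1)[of t] assms(2) at_within_Icc_at[of a t b] by simp
  show "vector_derivative f (at t) = f' t" using * by (rule vector_derivative_at)
qed

lemma tame_curve_C1:
  assumes "C1_on_interval f a b"
  shows "tame_curve f a b"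
proof -
  obtain f' where f': "continuous_on {a..b} f'"
      "\<And>t. t \<in> {a..b} \<Longrightarrow> (f has_vector_derivative f' t) (at t within {a..b})"
    using assms unfolding C1_on_interval_def by blast
  note vd = C1_on_interval_vector_derivative[of a b f f', OF f'(2)]
  have "continuous_on {a..b} f"
    using f'(2) has_vector_derivative_continuous continuous_on_eq_continuous_within by blast
  moreover have "\<forall>t\<in>{a<..<b} - {}. f differentiable (at t)"
    by (intro ballI differentiableI_vector[OF vd(1)]) auto
  moreover have "(\<lambda>t. norm (vector_derivative f (at t))) integrable_on {a..b}"
  proof (rule integrable_spike_finite[of "{a, b}"])
    show "(\<lambda>t. norm (f' t)) integrable_on {a..b}"
      using f'(1) by (intro integrable_continuous_real continuous_intros)
  qed (use vd(2) in auto)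
  ultimately show ?thesis unfolding tame_curve_def by blast
qed

lemma tame_curve_combine:
  assumes "tame_curve f a b" "tame_curve f b c" "a \<le> b" "b \<le> c"
  shows "tame_curve f a c"
proof -
  obtain S T where S: "finite S" "\<forall>t\<in>{a<..<b} - S. f differentiable (at t)"
    and T: "finite T" "\<forall>t\<in>{b<..<c} - T. f differentiable (at t)"
    using assms unfolding tame_curve_def by blast
  have "f differentiable (at t)" if "t \<in> {a<..<c} - insert b (S \<union> T)" for t
    using that S(2) T(2) by (cases "t < b") auto
  then have "finite (insert b (S \<union> T))" "\<forall>t\<in>{a<..<c} - insert b (S \<union> T). f differentiable (at t)"
    using S(1) T(1) by auto
  moreover have "{a..c} = {a..b} \<union> {b..c}" using assms by auto
  then have "continuous_on {a..c} f"
    using assms(1,2) by (simp add: tame_curve_def continuous_on_closed_Un)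
  moreover have "(\<lambda>t. norm (vector_derivative f (at t))) integrable_on {a..c}"
    using assms by (intro Henstock_Kurzweil_Integration.integrable_combine[of a b c]) (auto simp: tame_curve_def)
  ultimately show ?thesis unfolding tame_curve_def by blast
qed

lemma breakpoints_mono:
  fixes p :: "nat \<Rightarrow> real"
  assumes "\<forall>i<k. p i < p (Suc i)" and "i \<le> j" "j \<le> k"
  shows "p i \<le> p j"
  using assms(2,3)
proof (induction j)
  case (Suc j)
  show ?case
  proof (cases "i = Suc j")
    case False
    then have "p i \<le> p j" "p j < p (Suc j)" using Suc assms(1) by auto
    then show ?thesis by simp
  qed simp
qed auto

lemma tame_curve_piecewise_C1:
  assumes "piecewise_C1 f"
  shows "tame_curve f 0 1"
proof -
  obtain p k where p: "p 0 = 0" "p k = 1" "\<forall>i<k. p i < p (Suc i) \<and> C1_on_interval f (p i) (p (Suc i))"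
    using assms unfolding piecewise_C1_def by blast
  have "tame_curve f 0 (p i)" if "i \<le> k" for i
    using that
  proof (induction i)
    case 0
    show ?case using integrable_on_refl[of "\<lambda>t. norm (vector_derivative f (at t))" 0] p(1)
      by (simp add: tame_curve_def exI[of _ "{}"])
  next
    case (Suc i)
    show ?case
    proof (rule tame_curve_combine)
      show "tame_curve f (p i) (p (Suc i))" using p(3) Suc.prems by (auto intro: tame_curve_C1)
      show "0 \<le> p i" using breakpoints_mono[of k p 0 i] p Suc.prems by auto
    qed (use Suc p(3) in \<open>auto simp: less_imp_le\<close>)
  qed
  from this[of k] show ?thesis using p(2) by simp
qed

lemma tame_curve_subinterval:
  assumes "tame_curve f 0 1" "0 \<le> a" "b \<le> 1"
  shows "tame_curve f a b"
proof (cases "a \<le> b")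
  case True
  then have sub: "{a..b} \<subseteq> {0..1}" and "{a<..<b} \<subseteq> {0<..<1}" using assms by auto
  moreover obtain S where "finite S" "\<forall>t\<in>{0<..<1} - S. f differentiable (at t)"
    using assms(1) unfolding tame_curve_def by blast
  ultimately have "finite S" "\<forall>t\<in>{a<..<b} - S. f differentiable (at t)" by blast+
  moreover have "continuous_on {a..b} f"
    using assms(1) sub continuous_on_subset unfolding tame_curve_def by blast
  moreover have "(\<lambda>t. norm (vector_derivative f (at t))) integrable_on {a..b}"
    using assms(1) sub integrable_subinterval_real unfolding tame_curve_def by blast
  ultimately show ?thesis unfolding tame_curve_def by blast
qed (simp add: tame_curve_def exI[of _ "{}"] integrable_on_empty)

lemma tame_curve_integrable:
  fixes f :: "real \<Rightarrow> 'a::euclidean_space"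
  assumes "piecewise_C1 f" "0 \<le> a" "b \<le> 1"
  shows "(\<lambda>t. norm (vector_derivative f (at t))) integrable_on {a..b}"
  using tame_curve_subinterval[OF tame_curve_piecewise_C1[OF assms(1)] assms(2,3)]
  by (simp add: tame_curve_def)

lemma arc_length_add:
  assumes "piecewise_C1 \<gamma>" "0 \<le> a" "a \<le> b" "b \<le> c" "c \<le> 1"
  shows "arc_length \<gamma> a b + arc_length \<gamma> b c = arc_length \<gamma> a c"
  unfolding arc_length_eq
  by (rule Henstock_Kurzweil_Integration.integral_combine[OF assms(3,4) tame_curve_integrable[OF assms(1,2,5)]])

lemma arc_length_nonneg:
  assumes "piecewise_C1 \<gamma>" "0 \<le> a" "b \<le> 1"
  shows "0 \<le> arc_length \<gamma> a b"
  unfolding arc_length_eq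
  by (rule Henstock_Kurzweil_Integration.integral_nonneg[OF tame_curve_integrable[OF assms]]) simp

text \<open>On a smooth piece arc length is a constant plus the integral of the continuous function
  \<open>norm (f' t)\<close>, hence continuously differentiable even where the speed vanishes. For
  \<open>L = 0\<close> the quotient is constantly \<open>0\<close>.\<close>

lemma piecewise_C1_scaled_arc_length:
  assumes "piecewise_C1 \<gamma>"
  shows "piecewise_C1 (\<lambda>t. arc_length \<gamma> 0 t / L)"
proof -
  obtain p k where p: "p 0 = 0" "p k = 1" "\<forall>i<k. p i < p (Suc i) \<and> C1_on_interval \<gamma> (p i) (p (Suc i))"
    using assms unfolding piecewise_C1_def by blast
  have "C1_on_interval (\<lambda>t. arc_length \<gamma> 0 t / L) (p i) (p (Suc i))" if i: "i < k" for i
  proof -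
    let ?a = "p i" and ?b = "p (Suc i)"
    have ab: "0 \<le> ?a" "?b \<le> 1"
      using breakpoints_mono[of k p 0 i] breakpoints_mono[of k p "Suc i" k] p i by auto
    obtain f' where f': "continuous_on {?a..?b} f'"
        "\<And>t. t \<in> {?a..?b} \<Longrightarrow> (\<gamma> has_vector_derivative f' t) (at t within {?a..?b})"
      using p(3) i unfolding C1_on_interval_def by blast
    have eq: "arc_length \<gamma> 0 t / L = (arc_length \<gamma> 0 ?a + integral {?a..t} (\<lambda>t. norm (f' t))) / L"
      if t: "t \<in> {?a..?b}" for t
    proof -
      have "arc_length \<gamma> ?a t = integral {?a..t} (\<lambda>t. norm (f' t))"
        unfolding arc_length_eq
      proof (rule integral_spike[of "{?a, ?b}"])
        fix x assume "x \<in> {?a..t} - {?a, ?b}"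
        then have "x \<in> {?a<..<?b}" using t by auto
        then show "norm (f' x) = norm (vector_derivative \<gamma> (at x))"
          using C1_on_interval_vector_derivative(2)[of ?a ?b \<gamma> f', OF f'(2)] by simp
      qed simp
      then show ?thesis using arc_length_add[OF assms, of 0 ?a t] t ab by simp
    qed
    have "((\<lambda>t. arc_length \<gamma> 0 t / L) has_vector_derivative norm (f' t) / L) (at t within {?a..?b})"
      if t: "t \<in> {?a..?b}" for t
    proof (rule has_vector_derivative_transform[OF t eq])
      have "((\<lambda>t. integral {?a..t} (\<lambda>t. norm (f' t))) has_vector_derivative norm (f' t)) (at t within {?a..?b})"
        using f'(1) t by (intro integral_has_vector_derivative continuous_intros)
      then show "((\<lambda>t. (arc_length \<gamma> 0 ?a + integral {?a..t} (\<lambda>t. norm (f' t))) / L)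
          has_vector_derivative norm (f' t) / L) (at t within {?a..?b})"
        unfolding has_real_derivative_iff_has_vector_derivative[symmetric]
        using DERIV_cdivide[OF DERIV_add[OF DERIV_const]] by fastforce
    qed
    then show ?thesis
      unfolding C1_on_interval_def
    proof (intro exI[of _ "\<lambda>t. norm (f' t) / L"] conjI ballI)
      show "continuous_on {?a..?b} (\<lambda>t. norm (f' t) / L)"
        using f'(1) by (cases "L = 0") (auto intro!: continuous_intros)
    qed auto
  qed
  with p show ?thesis unfolding piecewise_C1_def by blast
qed

lemma piecewise_C1_smooth_compose:
  assumes s: "piecewise_C1 s" and E: "\<And>x. (E has_vector_derivative E' x) (at x)"
    and E': "continuous_on UNIV E'" and eq: "\<And>t. t \<in> {0..1} \<Longrightarrow> \<gamma> t = E (s t)"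
  shows "piecewise_C1 \<gamma>"
proof -
  obtain p k where p: "p 0 = 0" "p k = 1" "\<forall>i<k. p i < p (Suc i) \<and> C1_on_interval s (p i) (p (Suc i))"
    using s unfolding piecewise_C1_def by blast
  have "C1_on_interval \<gamma> (p i) (p (Suc i))" if i: "i < k" for i
  proof -
    let ?a = "p i" and ?b = "p (Suc i)"
    have ab: "0 \<le> ?a" "?b \<le> 1"
      using breakpoints_mono[of k p 0 i] breakpoints_mono[of k p "Suc i" k] p i by auto
    obtain s' where s': "continuous_on {?a..?b} s'"
        "\<And>t. t \<in> {?a..?b} \<Longrightarrow> (s has_vector_derivative s' t) (at t within {?a..?b})"
      using p(3) i unfolding C1_on_interval_def by blast
    have cs: "continuous_on {?a..?b} s"
      using s'(2) has_vector_derivative_continuous continuous_on_eq_continuous_within by blast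
    show ?thesis
      unfolding C1_on_interval_def
    proof (intro exI[of _ "\<lambda>t. s' t *\<^sub>R E' (s t)"] conjI ballI)
      show "continuous_on {?a..?b} (\<lambda>t. s' t *\<^sub>R E' (s t))"
        using continuous_on_compose2[OF E' cs subset_UNIV] by (rule continuous_on_scaleR[OF s'(1)])
      fix t assume t: "t \<in> {?a..?b}"
      show "(\<gamma> has_vector_derivative s' t *\<^sub>R E' (s t)) (at t within {?a..?b})"
      proof (rule has_vector_derivative_transform[OF t])
        show "\<gamma> x = (E \<circ> s) x" if "x \<in> {?a..?b}" for x using that ab eq by simp
        show "(E \<circ> s has_vector_derivative s' t *\<^sub>R E' (s t)) (at t within {?a..?b})"
          by (rule vector_diff_chain_within[OF s'(2)[OF t] has_vector_derivative_at_within[OF E]])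
      qed
    qed
  qed
  with p show ?thesis unfolding piecewise_C1_def by blast
qed

text \<open>The speed is \<open>c\<close> times the derivative of \<open>s\<close>, without a
  modulus because \<open>s\<close> is monotone, and it integrates to the increment of
  \<open>s\<close>. Intervals of rest are permitted.\<close>

lemma arc_length_smooth_compose:
  fixes E :: "real \<Rightarrow> real^'n^'n"
  assumes s: "piecewise_C1 s" "mono_on {0..1} s" and E: "\<And>x. (E has_vector_derivative E' x) (at x)"
    and norm: "\<And>x. norm (E' x) = c" and eq: "\<And>t. t \<in> {0..1} \<Longrightarrow> \<gamma> t = E (s t)"
    and ab: "0 \<le> a" "a \<le> b" "b \<le> 1"
  shows "arc_length \<gamma> a b = c * (s b - s a)"
proof -
  have tame: "tame_curve s a b"
    using tame_curve_subinterval[OF tame_curve_piecewise_C1[OF s(1)]] ab by simp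
  then obtain S where S: "finite S" "\<forall>t\<in>{a<..<b} - S. s differentiable (at t)"
    unfolding tame_curve_def by blast
  let ?s' = "\<lambda>t. vector_derivative s (at t)"
  have s': "(s has_vector_derivative ?s' t) (at t)" if "t \<in> {a<..<b} - S" for t
    using that S(2) by (simp add: vector_derivative_works)
  have "(?s' has_integral (s b - s a)) {a..b}"
    by (rule fundamental_theorem_of_calculus_interior_strong[OF S(1) ab(2) s'])
      (use tame in \<open>auto simp: tame_curve_def\<close>)
  then have int: "((\<lambda>t. c * ?s' t) has_integral (c * (s b - s a))) {a..b}"
    by (rule has_integral_mult_right)
  have spd: "norm (vector_derivative \<gamma> (at t)) = c * ?s' t" if "t \<in> {a..b} - (S \<union> {a, b})" for t
  proof -
    have t: "t \<in> {a<..<b} - S" using that by auto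
    have "(E \<circ> s has_vector_derivative ?s' t *\<^sub>R E' (s t)) (at t)"
      by (rule vector_diff_chain_at[OF s'[OF t] E])
    then have "(\<gamma> has_vector_derivative ?s' t *\<^sub>R E' (s t)) (at t)"
      by (rule has_vector_derivative_transform_within_open[of _ _ _ "{a<..<b}"]) (use t ab eq in auto)
    then have "norm (vector_derivative \<gamma> (at t)) = \<bar>?s' t\<bar> * c"
      by (simp add: vector_derivative_at norm)
    moreover have "?s' t \<ge> 0"
      by (rule mono_on_imp_deriv_nonneg[OF s(2)])
        (use s'[OF t] t ab in \<open>auto simp: has_real_derivative_iff_has_vector_derivative\<close>)
    ultimately show ?thesis by simp
  qed
  have "finite (S \<union> {a, b})" using S(1) by simp
  from has_integral_spike_finite[OF this spd int]
  have "((\<lambda>t. norm (vector_derivative \<gamma> (at t))) has_integral (c * (s b - s a))) {a..b}" .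
  then show ?thesis unfolding arc_length_eq by (rule integral_unique)
qed

section \<open>Angles along a curve of orthogonal matrices\<close>

text \<open>The factor \<open>\<rho> < 1\<close> keeps the argument away from \<open>\<plusminus> 1\<close>, where \<open>arccos\<close> is not differentiable;
  the bound on the derivative survives, and \<open>\<rho>\<close> tends to \<open>1\<close> after integration.\<close>

lemma regularized_arccos_derivative:
  fixes c :: "real \<Rightarrow> 'a::euclidean_space"
  assumes c: "(c has_vector_derivative c') (at t)" and unit: "norm (c t) = 1" "norm u = 1"
    and tangent: "c t \<bullet> c' = 0" and \<rho>: "0 \<le> \<rho>" "\<rho> < 1"
  obtains g where "((\<lambda>t. arccos (\<rho> * (u \<bullet> c t))) has_real_derivative g) (at t)" "\<bar>g\<bar> \<le> norm c'"
proof -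
  define f where "f = u \<bullet> c t"
  have f: "\<bar>f\<bar> \<le> 1"
    using Cauchy_Schwarz_ineq2[of u "c t"] unit by (simp add: f_def)
  have "\<bar>\<rho> * f\<bar> \<le> \<rho> * 1"
    unfolding abs_mult using f \<rho> by (simp add: mult_left_le)
  then have rf: "\<bar>\<rho> * f\<bar> < 1" using \<rho> by simp
  then have "(\<rho> * f)\<^sup>2 < 1" by (simp add: abs_square_less_1)
  define S where "S = sqrt (1 - (\<rho> * f)\<^sup>2)"
  have S: "S > 0" using \<open>(\<rho> * f)\<^sup>2 < 1\<close> by (simp add: S_def)
  have "((\<lambda>t. u \<bullet> c t) has_vector_derivative (u \<bullet> c')) (at t)"
    by (rule bounded_linear.has_vector_derivative[OF bounded_linear_inner_right c])
  then have "((\<lambda>t. \<rho> * (u \<bullet> c t)) has_real_derivative (\<rho> * (u \<bullet> c'))) (at t)"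
    unfolding has_real_derivative_iff_has_vector_derivative[symmetric] by (rule DERIV_cmult)
  moreover have "(arccos has_real_derivative inverse (- S)) (at (\<rho> * (u \<bullet> c t)))"
    using DERIV_arccos[of "\<rho> * f"] rf by (simp add: S_def f_def)
  ultimately have der: "((\<lambda>t. arccos (\<rho> * (u \<bullet> c t))) has_real_derivative (inverse (- S) * (\<rho> * (u \<bullet> c')))) (at t)"
    by (rule DERIV_chain2[rotated])
  \<comment> \<open>Tangency allows \<open>u\<close> to be replaced by its component orthogonal to
    \<open>c t\<close>, whose length is the sine of the angle and compensates the denominator
    \<open>S\<close>.\<close>
  have "u \<bullet> c' = (u - f *\<^sub>R c t) \<bullet> c'"
    using tangent by (simp add: inner_diff_left)
  then have "\<bar>u \<bullet> c'\<bar> \<le> norm (u - f *\<^sub>R c t) * norm c'"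
    using Cauchy_Schwarz_ineq2 by metis
  moreover have "(norm (u - f *\<^sub>R c t))\<^sup>2 = 1 - f\<^sup>2"
    using unit
    by (simp add: power2_norm_eq_inner inner_diff_left inner_diff_right f_def[symmetric] inner_commute norm_eq_1)
      (simp add: f_def inner_commute power2_eq_square)
  then have "norm (u - f *\<^sub>R c t) = sqrt (1 - f\<^sup>2)"
    by (metis norm_ge_zero real_sqrt_unique)
  \<comment> \<open>After squaring, this is just \<open>\<rho>\<^sup>2 \<le> 1\<close>.\<close>
  moreover have "\<rho> * sqrt (1 - f\<^sup>2) \<le> S"
  proof -
    have "\<rho>\<^sup>2 \<le> 1" using \<rho> by (simp add: power_le_one)
    then have "(\<rho> * sqrt (1 - f\<^sup>2))\<^sup>2 \<le> 1 - (\<rho> * f)\<^sup>2"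
      using f by (simp add: power_mult_distrib abs_square_le_1 right_diff_distrib)
    then show ?thesis unfolding S_def by (rule real_le_rsqrt)
  qed
  ultimately have "\<rho> * \<bar>u \<bullet> c'\<bar> \<le> S * norm c'"
    using \<rho>(1) by (smt (verit, ccfv_threshold) mult.assoc mult_left_mono mult_right_mono norm_ge_zero)
  then have "\<bar>inverse (- S) * (\<rho> * (u \<bullet> c'))\<bar> \<le> norm c'"
    using S \<rho>(1) by (simp add: abs_mult field_simps)
  then show ?thesis using der that by blast
qed

text \<open>Spherical distances between corresponding unit vectors. Keeping them as a vector rather
  than only their norm is what makes the equality case informative.\<close>

definition angle_vec :: "('n \<Rightarrow> real^'n) \<Rightarrow> ('n::finite \<Rightarrow> real^'n) \<Rightarrow> real^'n" where
  "angle_vec u w = (\<chi> j. arccos (u j \<bullet> w j))"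

lemma orthogonal_matrix_inner:
  "orthogonal_matrix (A :: real^'n^'n) \<Longrightarrow> (A *v x) \<bullet> (A *v y) = x \<bullet> y"
  unfolding inner_matrix_transpose by (simp add: matrix_vector_mul_assoc orthogonal_matrix_def del: transpose_matrix_vector)

lemma orthogonal_matrix_norm_image:
  "orthogonal_matrix (A :: real^'n^'n) \<Longrightarrow> norm (A *v x) = norm x"
  by (simp add: norm_eq_sqrt_inner orthogonal_matrix_inner)

lemma orthogonal_group_curve:
  "\<gamma> ` {0..1} \<subseteq> orthogonal_group \<Longrightarrow> 0 \<le> t \<Longrightarrow> t \<le> (1::real) \<Longrightarrow> orthogonal_matrix (\<gamma> t)"
  unfolding orthogonal_group_def image_subset_iff by simp

text \<open>Component \<open>j\<close> of \<open>\<Phi>\<close> changes at most as fast as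
  \<open>\<gamma> t *v v j\<close>, and the squares of these speeds add up to the square of the
  Frobenius speed.\<close>

lemma regularized_angle_bound:
  fixes \<gamma> :: "real \<Rightarrow> real^'n^'n" and v u :: "'n \<Rightarrow> real^'n"
  assumes \<gamma>: "piecewise_C1 \<gamma>" "\<gamma> ` {0..1} \<subseteq> orthogonal_group"
    and v: "orthonormal_frame v" and u: "\<And>j. norm (u j) = 1"
    and ab: "0 \<le> a" "a \<le> b" "b \<le> 1" and \<rho>: "0 \<le> \<rho>" "\<rho> < 1"
  defines "\<Phi> \<equiv> \<lambda>t. \<chi> j. arccos (\<rho> * (u j \<bullet> (\<gamma> t *v v j)))"
  shows "norm (\<Phi> b - \<Phi> a) \<le> arc_length \<gamma> a b"
proof -
  have tame: "tame_curve \<gamma> a b"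
    using tame_curve_subinterval[OF tame_curve_piecewise_C1[OF \<gamma>(1)]] ab by simp
  then obtain S where S: "finite S" "\<forall>t\<in>{a<..<b} - S. \<gamma> differentiable (at t)"
    unfolding tame_curve_def by blast
  have unit: "norm (\<gamma> t *v v j) = 1" if "t \<in> {a..b}" for t j
    using orthogonal_group_curve[OF \<gamma>(2), of t] that ab orthonormal_frame_norm[OF v]
    by (simp add: orthogonal_matrix_norm_image)
  have "\<exists>D. (\<Phi> has_vector_derivative D) (at t) \<and> norm D \<le> norm (vector_derivative \<gamma> (at t))"
    if t: "t \<in> {a<..<b} - S" for t
  proof -
    define V where "V = vector_derivative \<gamma> (at t)"
    have "(\<gamma> has_vector_derivative V) (at t)"
      using t S(2) by (simp add: V_def vector_derivative_works)
    then have der: "((\<lambda>t. \<gamma> t *v v j) has_vector_derivative (V *v v j)) (at t)" for j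
      by (rule bounded_linear.has_vector_derivative[OF bounded_linear_matrix_apply])
    have tangent: "(\<gamma> t *v v j) \<bullet> (V *v v j) = 0" for j
    proof -
      have "((\<lambda>t. (\<gamma> t *v v j) \<bullet> (\<gamma> t *v v j)) has_vector_derivative
          ((\<gamma> t *v v j) \<bullet> (V *v v j) + (V *v v j) \<bullet> (\<gamma> t *v v j))) (at t)"
        by (rule bounded_bilinear.has_vector_derivative[OF bounded_bilinear_inner der der])
      moreover have "((\<lambda>t. (\<gamma> t *v v j) \<bullet> (\<gamma> t *v v j)) has_vector_derivative 0) (at t)"
        by (rule has_vector_derivative_transform_within_open[of "\<lambda>t. 1" _ _ "{a<..<b}"])
          (use t unit in \<open>auto simp: norm_eq_1\<close>)
      ultimately show ?thesis
        using vector_derivative_unique_at by (fastforce simp: inner_commute)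
    qed
    have "\<exists>g. ((\<lambda>t. arccos (\<rho> * (u j \<bullet> (\<gamma> t *v v j)))) has_real_derivative g) (at t) \<and> \<bar>g\<bar> \<le> norm (V *v v j)" for j
    proof (rule regularized_arccos_derivative[OF der unit u tangent \<rho>])
      show "t \<in> {a..b}" using t by simp
    qed blast
    then have "\<forall>j. \<exists>g. ((\<lambda>t. arccos (\<rho> * (u j \<bullet> (\<gamma> t *v v j)))) has_real_derivative g) (at t) \<and> \<bar>g\<bar> \<le> norm (V *v v j)"
      by blast
    from choice[OF this] obtain g
      where g: "\<And>j. ((\<lambda>t. arccos (\<rho> * (u j \<bullet> (\<gamma> t *v v j)))) has_real_derivative g j) (at t)"
        "\<And>j. \<bar>g j\<bar> \<le> norm (V *v v j)" by blast
    have "(\<Phi> has_vector_derivative (\<chi> j. g j)) (at t)"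
      unfolding \<Phi>_def using g(1)
      by (intro vec_has_vector_derivativeI) (simp add: has_real_derivative_iff_has_vector_derivative)
    moreover have "(norm (\<chi> j. g j))\<^sup>2 \<le> (norm V)\<^sup>2"
    proof -
      have "(norm (\<chi> j. g j))\<^sup>2 = (\<Sum>j\<in>UNIV. (g j)\<^sup>2)"
        unfolding power2_norm_eq_inner inner_vec_def by (simp add: power2_eq_square)
      also have "\<dots> \<le> (\<Sum>j\<in>UNIV. (norm (V *v v j))\<^sup>2)"
        using g(2) by (intro sum_mono) (simp add: abs_le_square_iff[symmetric])
      finally show ?thesis by (simp add: norm_matrix_sq_frame[OF v])
    qed
    then have "norm (\<chi> j. g j) \<le> norm V" by (rule power2_le_imp_le) simp
    ultimately show ?thesis unfolding V_def by blast
  qed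
  then have "\<forall>t\<in>{a<..<b} - S. \<exists>D. (\<Phi> has_vector_derivative D) (at t) \<and> norm D \<le> norm (vector_derivative \<gamma> (at t))"
    by blast
  from bchoice[OF this] obtain D where D: "\<And>t. t \<in> {a<..<b} - S \<Longrightarrow> (\<Phi> has_vector_derivative D t) (at t)"
      "\<And>t. t \<in> {a<..<b} - S \<Longrightarrow> norm (D t) \<le> norm (vector_derivative \<gamma> (at t))" by blast
  \<comment> \<open>\<open>D\<close> is controlled only at points of differentiability; the value
    \<open>0\<close> elsewhere makes the bound by the speed hold at every \<open>t\<close>.\<close>
  define D' where "D' t = (if t \<in> {a<..<b} - S then D t else 0)" for t
  have "(D' has_integral (\<Phi> b - \<Phi> a)) {a..b}"
  proof (rule fundamental_theorem_of_calculus_interior_strong[OF S(1) ab(2)])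
    show "(\<Phi> has_vector_derivative D' t) (at t)" if "t \<in> {a<..<b} - S" for t
      using D(1)[OF that] that by (simp add: D'_def)
    have "continuous_on {a..b} (\<lambda>t. \<gamma> t *v v j)" for j
      using tame linear_continuous_on_compose[OF _ bounded_linear.linear[OF bounded_linear_matrix_apply]]
      unfolding tame_curve_def by blast
    moreover have "\<bar>\<rho> * (u j \<bullet> (\<gamma> t *v v j))\<bar> \<le> 1" if "t \<in> {a..b}" for t j
    proof -
      have "\<bar>u j \<bullet> (\<gamma> t *v v j)\<bar> \<le> 1"
        using Cauchy_Schwarz_ineq2[of "u j" "\<gamma> t *v v j"] unit[OF that] u by simp
      then show ?thesis using \<rho> by (simp add: abs_mult mult_le_one)
    qed
    ultimately show "continuous_on {a..b} \<Phi>"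
      unfolding \<Phi>_def by (intro continuous_intros) (auto simp: abs_le_iff)
  qed
  moreover have "norm (D' t) \<le> norm (vector_derivative \<gamma> (at t))" for t
    using D(2) by (simp add: D'_def)
  then have "norm (integral {a..b} D') \<le> arc_length \<gamma> a b"
    unfolding arc_length_eq
    using calculation tame_curve_integrable[OF \<gamma>(1) ab(1,3)]
    by (intro Henstock_Kurzweil_Integration.integral_norm_bound_integral) auto
  ultimately show ?thesis by (simp add: integral_unique)
qed

text \<open>Let the factor \<open>r n\<close> tend to 1 and use continuity of \<open>arccos\<close>
  on the closed interval. Since \<open>u\<close> is any family of unit vectors, angles from one
  point of the curve can be compared at two other times.\<close>

lemma angle_vec_bound:
  fixes \<gamma> :: "real \<Rightarrow> real^'n^'n" and v u :: "'n \<Rightarrow> real^'n"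
  assumes \<gamma>: "piecewise_C1 \<gamma>" "\<gamma> ` {0..1} \<subseteq> orthogonal_group"
    and v: "orthonormal_frame v" and u: "\<And>j. norm (u j) = 1"
    and ab: "0 \<le> a" "a \<le> b" "b \<le> 1"
  shows "norm (angle_vec u (\<lambda>j. \<gamma> b *v v j) - angle_vec u (\<lambda>j. \<gamma> a *v v j)) \<le> arc_length \<gamma> a b"
proof -
  define r where "r n = real n / real (Suc n)" for n
  have r: "0 \<le> r n" "r n < 1" for n by (simp_all add: r_def)
  have r1: "r \<longlonglongrightarrow> 1" unfolding r_def by (rule LIMSEQ_n_over_Suc_n)
  define \<Phi> where "\<Phi> n t = (\<chi> j. arccos (r n * (u j \<bullet> (\<gamma> t *v v j))))" for n t
  have lim: "(\<lambda>n. \<Phi> n t) \<longlonglongrightarrow> angle_vec u (\<lambda>j. \<gamma> t *v v j)" if t: "t \<in> {0..1}" for t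
    unfolding \<Phi>_def angle_vec_def
  proof (rule tendsto_vec_lambda)
    fix j
    let ?x = "u j \<bullet> (\<gamma> t *v v j)"
    have "norm (\<gamma> t *v v j) = 1"
      using orthogonal_group_curve[OF \<gamma>(2), of t] t orthonormal_frame_norm[OF v]
      by (simp add: orthogonal_matrix_norm_image)
    then have x: "\<bar>?x\<bar> \<le> 1"
      using Cauchy_Schwarz_ineq2[of "u j" "\<gamma> t *v v j"] u by simp
    have "r n * ?x \<in> {-1..1}" for n
    proof -
      have "\<bar>r n * ?x\<bar> \<le> 1" using r[of n] x unfolding abs_mult by (intro mult_le_one) auto
      then show ?thesis by auto
    qed
    moreover have "(\<lambda>n. r n * ?x) \<longlonglongrightarrow> ?x"
      using tendsto_mult_right[OF r1, of ?x] by simp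
    ultimately show "(\<lambda>n. arccos (r n * ?x)) \<longlonglongrightarrow> arccos ?x"
      using x by (intro continuous_on_tendsto_compose[OF continuous_on_arccos']) auto
  qed
  have "(\<lambda>n. norm (\<Phi> n b - \<Phi> n a)) \<longlonglongrightarrow>
      norm (angle_vec u (\<lambda>j. \<gamma> b *v v j) - angle_vec u (\<lambda>j. \<gamma> a *v v j))"
    using ab by (intro tendsto_norm tendsto_diff lim) auto
  then show ?thesis
    by (rule LIMSEQ_le_const2) (use regularized_angle_bound[OF assms r] in \<open>auto simp: \<Phi>_def\<close>)
qed

section \<open>Rigidity of curves of minimal length\<close>

text \<open>Both bounds must be attained, which is the equality case of the triangle inequality and
  makes \<open>x\<close> and \<open>y\<close> parallel. The multiplied-out form tolerates
  \<open>p + q = 0\<close>.\<close>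

lemma norm_triangle_equality_split:
  fixes x y :: "'a::real_inner"
  assumes "norm x \<le> p" "norm y \<le> q" "norm (x + y) = p + q"
  shows "(p + q) *\<^sub>R x = p *\<^sub>R (x + y)"
proof -
  have "norm x = p" "norm y = q"
    using assms norm_triangle_ineq[of x y] by auto
  then have "p *\<^sub>R y = q *\<^sub>R x"
    using assms(3) norm_triangle_eq[of x y] by simp
  then show ?thesis by (simp add: scaleR_add_left scaleR_add_right)
qed

lemma angle_vec_commute: "angle_vec u w = angle_vec w u"
  by (simp add: angle_vec_def inner_commute)

lemma angle_vec_self: "(\<And>j. norm (u j) = 1) \<Longrightarrow> angle_vec u u = 0"
  by (simp add: angle_vec_def vec_eq_iff norm_eq_1)

text \<open>The starting vectors serve as reference, so one of the two compared angle vectors is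
  \<open>0\<close>.\<close>

theorem angle_vec_le_curve_length:
  fixes \<gamma> :: "real \<Rightarrow> real^'n^'n" and v :: "'n \<Rightarrow> real^'n"
  assumes \<gamma>: "piecewise_C1 \<gamma>" "\<gamma> ` {0..1} \<subseteq> orthogonal_group" and v: "orthonormal_frame v"
    and ab: "0 \<le> a" "a \<le> b" "b \<le> 1"
  shows "norm (angle_vec (\<lambda>j. \<gamma> a *v v j) (\<lambda>j. \<gamma> b *v v j)) \<le> arc_length \<gamma> a b"
proof -
  have "norm (\<gamma> a *v v j) = 1" for j
    using orthogonal_group_curve[OF \<gamma>(2), of a] ab orthonormal_frame_norm[OF v]
    by (simp add: orthogonal_matrix_norm_image)
  then show ?thesis
    using angle_vec_bound[OF \<gamma> v _ ab, of "\<lambda>j. \<gamma> a *v v j"] by (simp add: angle_vec_self)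
qed

text \<open>The equality case of the triangle inequality is used twice: with reference
  \<open>\<gamma> 1\<close> at the times 0, \<open>a\<close>, 1, which settles the angles between
  \<open>a\<close> and 1, and then with reference \<open>\<gamma> a\<close> at the times
  \<open>a\<close>, \<open>b\<close>, 1.\<close>

lemma minimal_curve_angle_vec:
  fixes \<gamma> :: "real \<Rightarrow> real^'n^'n" and v :: "'n \<Rightarrow> real^'n"
  assumes \<gamma>: "piecewise_C1 \<gamma>" "\<gamma> ` {0..1} \<subseteq> orthogonal_group" and v: "orthonormal_frame v"
    and \<theta>: "angle_vec (\<lambda>j. \<gamma> 0 *v v j) (\<lambda>j. \<gamma> 1 *v v j) = \<theta>" and len: "arc_length \<gamma> 0 1 = norm \<theta>"
    and ab: "0 \<le> a" "a \<le> b" "b \<le> 1"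
  shows "angle_vec (\<lambda>j. \<gamma> a *v v j) (\<lambda>j. \<gamma> b *v v j) = (arc_length \<gamma> a b / norm \<theta>) *\<^sub>R \<theta>"
proof -
  define w where "w t = (\<lambda>j. \<gamma> t *v v j)" for t
  define l where "l = arc_length \<gamma>"
  define L where "L = norm \<theta>"
  have unit: "norm (w t j) = 1" if "0 \<le> t" "t \<le> 1" for t j
    using orthogonal_group_curve[OF \<gamma>(2), of t] that orthonormal_frame_norm[OF v]
    by (simp add: w_def orthogonal_matrix_norm_image)
  have bound: "norm (angle_vec (w x) (w t) - angle_vec (w x) (w s)) \<le> l s t"
    if "0 \<le> x" "x \<le> 1" "0 \<le> s" "s \<le> t" "t \<le> 1" for x s t
    using angle_vec_bound[OF \<gamma> v, of "w x" s t] unit that unfolding w_def l_def by blast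
  have self: "angle_vec (w t) (w t) = 0" if "0 \<le> t" "t \<le> 1" for t
    using unit that by (intro angle_vec_self)
  have split: "l s t + l t u = l s u" if "0 \<le> s" "s \<le> t" "t \<le> u" "u \<le> 1" for s t u
    using arc_length_add[OF \<gamma>(1)] that by (simp add: l_def)
  have nonneg: "0 \<le> l s t" if "0 \<le> s" "t \<le> 1" for s t
    using arc_length_nonneg[OF \<gamma>(1)] that by (simp add: l_def)
  have \<theta>': "angle_vec (w 0) (w 1) = \<theta>" using \<theta> by (simp add: w_def)
  have l01: "l 0 a + l a 1 = L" "l a b + l b 1 = l a 1"
    using split[of 0 a 1] split[of a b 1] ab len by (auto simp: l_def L_def)
  have A1: "L *\<^sub>R angle_vec (w a) (w 1) = l a 1 *\<^sub>R \<theta>"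
  proof -
    let ?x = "angle_vec (w 1) (w a)"
    have "norm ?x \<le> l a 1"
      using bound[of 1 a 1] self[of 1] ab by (simp add: norm_minus_commute)
    moreover have "norm (\<theta> - ?x) \<le> l 0 a"
      using bound[of 1 0 a] \<theta>' ab angle_vec_commute[of "w 1" "w 0"] by (simp add: norm_minus_commute)
    moreover have "norm (?x + (\<theta> - ?x)) = l a 1 + l 0 a"
      using l01 by (simp add: L_def)
    ultimately have "(l a 1 + l 0 a) *\<^sub>R ?x = l a 1 *\<^sub>R (?x + (\<theta> - ?x))"
      by (rule norm_triangle_equality_split)
    then show ?thesis using l01 angle_vec_commute[of "w 1" "w a"] by (simp add: add.commute)
  qed
  let ?y = "angle_vec (w a) (w b)" and ?z = "angle_vec (w a) (w 1)"
  have y: "norm ?y \<le> l a b"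
    using bound[of a a b] self[of a] ab by simp
  show ?thesis
  \<comment> \<open>If the arc from \<open>a\<close> to \<open>b\<close> has length
    \<open>0\<close>, both sides vanish; otherwise \<open>l a 1\<close> is positive and can be
    cancelled.\<close>
  proof (cases "L = 0 \<or> l a b = 0")
    case True
    then have "l a b = 0"
      using l01 nonneg[of 0 a] nonneg[of b 1] nonneg[of a b] ab by linarith
    then show ?thesis using y by (simp add: w_def l_def)
  next
    case False
    then have pos: "L > 0" "l a b > 0" "l a 1 > 0"
      using l01 nonneg[of a b] nonneg[of b 1] ab by (auto simp: L_def)
    have "norm (?z - ?y) \<le> l b 1"
      using bound[of a b 1] ab by simp
    moreover have "norm (?y + (?z - ?y)) = l a b + l b 1"
    proof -
      have "L * norm ?z = l a 1 * L"
        using arg_cong[OF A1, of norm] pos by (simp add: L_def)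
      then show ?thesis using pos l01 by simp
    qed
    ultimately have "(l a b + l b 1) *\<^sub>R ?y = l a b *\<^sub>R (?y + (?z - ?y))"
      by (rule norm_triangle_equality_split[OF y])
    then have "l a 1 *\<^sub>R ?y = l a b *\<^sub>R ?z" using l01 by simp
    then have "L *\<^sub>R (l a 1 *\<^sub>R ?y) = l a b *\<^sub>R (L *\<^sub>R ?z)"
      by (simp add: mult.commute)
    then have "l a 1 *\<^sub>R (L *\<^sub>R ?y) = l a 1 *\<^sub>R (l a b *\<^sub>R \<theta>)"
      unfolding A1 by (simp add: mult.commute)
    then have "L *\<^sub>R ?y = l a b *\<^sub>R \<theta>"
      using pos by (metis order_less_irrefl scaleR_cancel_left)
    then have "(1 / L) *\<^sub>R (L *\<^sub>R ?y) = (1 / L) *\<^sub>R (l a b *\<^sub>R \<theta>)" by simp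
    then show ?thesis using pos by (simp add: w_def l_def L_def)
  qed
qed

text \<open>Normalising the part of \<open>y\<close> orthogonal to \<open>x\<close> gives a unit
  vector \<open>w\<close>. The given inner products say that \<open>z\<close> has coordinates
  \<open>cos \<beta>\<close> and \<open>sin \<beta>\<close> along \<open>x\<close> and
  \<open>w\<close>, and \<open>norm z = 1\<close> leaves no room for a further component.\<close>

lemma great_circle_point:
  fixes x y z :: "'a::real_inner"
  assumes unit: "norm x = 1" "norm y = 1" "norm z = 1" and sin: "sin \<alpha> \<noteq> 0"
    and xy: "x \<bullet> y = cos \<alpha>" and xz: "x \<bullet> z = cos \<beta>" and yz: "y \<bullet> z = cos (\<alpha> - \<beta>)"
  shows "z = cos \<beta> *\<^sub>R x + sin \<beta> *\<^sub>R ((1 / sin \<alpha>) *\<^sub>R (y - cos \<alpha> *\<^sub>R x))"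
proof -
  define w where "w = (1 / sin \<alpha>) *\<^sub>R (y - cos \<alpha> *\<^sub>R x)"
  have xx: "x \<bullet> x = 1" and yy: "y \<bullet> y = 1" and zz: "z \<bullet> z = 1"
    using unit by (auto simp: norm_eq_1)
  have yx: "y \<bullet> x = cos \<alpha>" using xy by (simp add: inner_commute)
  have xw: "x \<bullet> w = 0" by (simp add: w_def inner_diff_right xx xy)
  have "w \<bullet> w = (1 - (cos \<alpha>)\<^sup>2) / (sin \<alpha>)\<^sup>2"
    by (simp add: w_def inner_diff_right inner_diff_left xx xy yx yy power2_eq_square)
  then have ww: "w \<bullet> w = 1" using sin by (simp add: sin_squared_eq[symmetric])
  have "w \<bullet> z = (cos (\<alpha> - \<beta>) - cos \<alpha> * cos \<beta>) / sin \<alpha>"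
    by (simp add: w_def inner_diff_left xz yz)
  then have wz: "w \<bullet> z = sin \<beta>" using sin by (simp add: cos_diff)
  define d where "d = z - (cos \<beta> *\<^sub>R x + sin \<beta> *\<^sub>R w)"
  have "d \<bullet> z = z \<bullet> z - (cos \<beta> * (x \<bullet> z) + sin \<beta> * (w \<bullet> z))"
    by (simp add: d_def inner_diff_left inner_add_left)
  also have "\<dots> = 0"
    unfolding zz xz wz using sin_cos_squared_add3[of \<beta>] by linarith
  finally have "d \<bullet> z = 0" .
  moreover have "d \<bullet> x = 0" "d \<bullet> w = 0"
    using xw by (simp_all add: d_def inner_diff_left inner_add_left inner_diff_right inner_add_right xx ww inner_commute xz wz)
  ultimately have "d \<bullet> d = 0"
    using inner_diff_right[of d z "cos \<beta> *\<^sub>R x + sin \<beta> *\<^sub>R w"]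
    by (simp add: d_def[symmetric] inner_add_right)
  then show ?thesis by (simp add: d_def w_def)
qed

text \<open>The end points are included because derivatives within a closed interval are unique; the
  applications are at \<open>0\<close>, where constancy is known on one side only.\<close>

lemma constant_on_deriv_zero:
  fixes f :: "real \<Rightarrow> real"
  assumes "\<And>x. (f has_real_derivative f' x) (at x)" "\<And>x. x \<in> {0..1} \<Longrightarrow> f x = k" "x \<in> {0..1}"
  shows "f' x = 0"
proof -
  have "(f has_vector_derivative f' x) (at x within {0..1})"
    using assms(1)[of x] has_real_derivative_iff_has_vector_derivative has_vector_derivative_at_within by blast
  moreover have "(f has_vector_derivative 0) (at x within {0..1})"
    by (rule has_vector_derivative_transform[OF assms(3), of _ "\<lambda>x. k"]) (use assms(2) in auto)
  ultimately show ?thesis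
    using vector_derivative_unique_within_closed_interval[of 0 1 x f "f' x" 0] assms(3) by simp
qed

text \<open>For skew \<open>B\<close> the entries of \<open>B ** B\<close> in the frame are minus
  the inner products of the images of frame vectors, so orthogonal images of length
  \<open>\<theta> j\<close> are just what is required. This serves both rigidity and the
  construction of logarithms.\<close>

lemma skew_spectrum_frame_matrix:
  fixes v w :: "'n::finite \<Rightarrow> real^'n"
  assumes v: "orthonormal_frame v" and \<theta>: "\<And>j. 0 \<le> \<theta> j"
    and skew: "\<And>i j. v i \<bullet> w j = - (v j \<bullet> w i)"
    and gram: "\<And>i j. w i \<bullet> w j = (if i = j then (\<theta> i)\<^sup>2 else 0)"
  shows "skew_spectrum (frame_matrix v w) v \<theta>"
proof -
  define B where "B = frame_matrix v w"
  have Bv: "B *v v j = w j" for j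
    unfolding B_def by (rule frame_matrix_apply[OF v])
  have "v i \<bullet> (B *v v j) = ((- B) *v v i) \<bullet> v j" for i j
  proof -
    have "(- B) *v v i = - (B *v v i)"
      by (simp add: vec_eq_iff matrix_vector_mult_def sum_negf)
    then show ?thesis using skew[of i j] by (simp add: Bv inner_commute)
  qed
  then have B: "transpose B = - B" by (rule transpose_eq_on_frame[OF v])
  have "B *v (B *v v j) = - (\<theta> j)\<^sup>2 *\<^sub>R v j" for j
  proof (rule orthonormal_frame_eqI[OF v])
    fix i
    have "(B *v (B *v v j)) \<bullet> v i = - ((B *v v i) \<bullet> (B *v v j))"
      using skew_inner[OF B, of "v i" "B *v v j"] by (simp add: inner_commute)
    also have "\<dots> = - (w i \<bullet> w j)"
      by (simp add: Bv)
    finally show "(B *v (B *v v j)) \<bullet> v i = (- (\<theta> j)\<^sup>2 *\<^sub>R v j) \<bullet> v i"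
      unfolding gram using orthonormal_frame_inner[OF v, of j i] by simp
  qed
  then show ?thesis using B v \<theta> by (simp add: skew_spectrum_def B_def)
qed

text \<open>Comparing the first two derivatives at \<open>0\<close> of \<open>\<Gamma>\<^sup>T \<Gamma> = I\<close>, where \<open>\<Gamma> \<sigma>\<close> maps
  \<open>v\<^sub>j\<close> to \<open>cos (\<sigma> \<theta>\<^sub>j) v\<^sub>j + sin (\<sigma> \<theta>\<^sub>j) w\<^sub>j\<close>, shows that \<open>B = \<Gamma>' 0\<close> is skew with
  \<open>B\<^sup>2 v\<^sub>j = - \<theta>\<^sub>j\<^sup>2 v\<^sub>j\<close>.\<close>

lemma skew_spectrum_from_circles:
  fixes v w :: "'n::finite \<Rightarrow> real^'n"
  assumes v: "orthonormal_frame v" and \<theta>: "\<And>j. 0 \<le> \<theta> j"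
    and \<Gamma>: "\<And>\<sigma>. \<sigma> \<in> {0..1} \<Longrightarrow> orthonormal_frame (\<lambda>j. cos (\<sigma> * \<theta> j) *\<^sub>R v j + sin (\<sigma> * \<theta> j) *\<^sub>R w j)"
  shows "skew_spectrum (frame_matrix v (\<lambda>j. \<theta> j *\<^sub>R w j)) v \<theta>"
proof -
  have first: "\<theta> j * (v i \<bullet> w j) + \<theta> i * (w i \<bullet> v j) = 0"
    and second: "\<theta> i * \<theta> j * (w i \<bullet> w j) = (if i = j then (\<theta> i)\<^sup>2 else 0)" for i j
  proof -
    define d :: real where "d = (if i = j then 1 else 0)"
    define a where "a = v i \<bullet> w j"
    define b where "b = w i \<bullet> v j"
    define c where "c = w i \<bullet> w j"
    \<comment> \<open>The inner product of the moving vectors \<open>i\<close> and \<open>j\<close>.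
      Its derivatives are grouped by trigonometric products, so that only the one with two cosines
      survives at \<open>0\<close>.\<close>
    define f where "f \<sigma> = cos (\<sigma> * \<theta> i) * cos (\<sigma> * \<theta> j) * d + cos (\<sigma> * \<theta> i) * sin (\<sigma> * \<theta> j) * a
        + sin (\<sigma> * \<theta> i) * cos (\<sigma> * \<theta> j) * b + sin (\<sigma> * \<theta> i) * sin (\<sigma> * \<theta> j) * c" for \<sigma>
    have f: "f \<sigma> = d" if "\<sigma> \<in> {0..1}" for \<sigma>
      using orthonormal_frame_inner[OF \<Gamma>[OF that], of i j] orthonormal_frame_inner[OF v, of i j]
      by (simp add: f_def d_def a_def b_def c_def inner_add_left inner_add_right algebra_simps)
    define f' where "f' \<sigma> = (cos (\<sigma> * \<theta> i) * cos (\<sigma> * \<theta> j)) * (\<theta> j * a + \<theta> i * b)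
        + (cos (\<sigma> * \<theta> i) * sin (\<sigma> * \<theta> j)) * (\<theta> i * c - \<theta> j * d)
        + (sin (\<sigma> * \<theta> i) * cos (\<sigma> * \<theta> j)) * (\<theta> j * c - \<theta> i * d)
        - (sin (\<sigma> * \<theta> i) * sin (\<sigma> * \<theta> j)) * (\<theta> i * a + \<theta> j * b)" for \<sigma>
    have "(f has_real_derivative f' \<sigma>) (at \<sigma>)" for \<sigma>
      unfolding f_def f'_def
      by (rule derivative_eq_intros refl)+ (simp add: algebra_simps)
    note f'0 = constant_on_deriv_zero[OF this f]
    define f'' where "f'' \<sigma> = (cos (\<sigma> * \<theta> i) * cos (\<sigma> * \<theta> j)) * (\<theta> j * (\<theta> i * c - \<theta> j * d) + \<theta> i * (\<theta> j * c - \<theta> i * d))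
        - (cos (\<sigma> * \<theta> i) * sin (\<sigma> * \<theta> j)) * (\<theta> j * (\<theta> j * a + \<theta> i * b) + \<theta> i * (\<theta> i * a + \<theta> j * b))
        - (sin (\<sigma> * \<theta> i) * cos (\<sigma> * \<theta> j)) * (\<theta> i * (\<theta> j * a + \<theta> i * b) + \<theta> j * (\<theta> i * a + \<theta> j * b))
        - (sin (\<sigma> * \<theta> i) * sin (\<sigma> * \<theta> j)) * (\<theta> i * (\<theta> i * c - \<theta> j * d) + \<theta> j * (\<theta> j * c - \<theta> i * d))" for \<sigma>
    have "(f' has_real_derivative f'' \<sigma>) (at \<sigma>)" for \<sigma>
      unfolding f'_def f''_def
      by (rule derivative_eq_intros refl)+ (simp add: algebra_simps)
    note f''0 = constant_on_deriv_zero[OF this f'0]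
    show "\<theta> j * (v i \<bullet> w j) + \<theta> i * (w i \<bullet> v j) = 0"
      using f'0[of 0] by (simp add: f'_def a_def b_def)
    have "2 * (\<theta> i * \<theta> j * c) = ((\<theta> i)\<^sup>2 + (\<theta> j)\<^sup>2) * d"
      using f''0[of 0] by (simp add: f''_def algebra_simps power2_eq_square)
    then show "\<theta> i * \<theta> j * (w i \<bullet> w j) = (if i = j then (\<theta> i)\<^sup>2 else 0)"
      by (auto simp: c_def d_def)
  qed
  show ?thesis
  proof (rule skew_spectrum_frame_matrix[OF v \<theta>])
    show "v i \<bullet> (\<theta> j *\<^sub>R w j) = - (v j \<bullet> (\<theta> i *\<^sub>R w i))" for i j
      using first[of j i] by (simp add: inner_commute)
    show "(\<theta> i *\<^sub>R w i) \<bullet> (\<theta> j *\<^sub>R w j) = (if i = j then (\<theta> i)\<^sup>2 else 0)" for i j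
      using second[of i j] by (cases "i = j") (auto simp: mult.assoc)
  qed
qed

lemma unit_inner_one_eq:
  fixes x y :: "'a::real_inner"
  assumes "norm x = 1" "norm y = 1" "x \<bullet> y = 1"
  shows "x = y"
proof -
  have "(x - y) \<bullet> (x - y) = 0"
    using assms by (simp add: inner_diff_left inner_diff_right norm_eq_1 inner_commute)
  then show ?thesis by simp
qed

text \<open>Moving the curve back to the identity gives vectors \<open>y t j\<close> starting at
  \<open>v j\<close>. Minimality fixes their cosines between any two times, not only from the start,
  so each \<open>y t j\<close> is located by its angles to two reference points.\<close>

theorem minimal_length_rigidity:
  fixes \<gamma> :: "real \<Rightarrow> real^'n^'n" and v :: "'n \<Rightarrow> real^'n"
  assumes \<gamma>: "piecewise_C1 \<gamma>" "\<gamma> ` {0..1} \<subseteq> orthogonal_group" and v: "orthonormal_frame v"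
    and \<theta>: "\<And>j. \<theta> j \<in> {0..pi}" and ends: "\<And>j. (\<gamma> 0 *v v j) \<bullet> (\<gamma> 1 *v v j) = cos (\<theta> j)"
    and L: "L = sqrt (\<Sum>j\<in>UNIV. (\<theta> j)\<^sup>2)" and len: "arc_length \<gamma> 0 1 = L"
  obtains B where "skew_spectrum B v \<theta>"
    "\<And>t. t \<in> {0..1} \<Longrightarrow> \<gamma> t = \<gamma> 0 ** mexp ((arc_length \<gamma> 0 t / L) *\<^sub>R B)"
proof -
  define s where "s t = arc_length \<gamma> 0 t / L" for t
  have orth: "orthogonal_matrix (\<gamma> t)" if "t \<in> {0..1}" for t
    using orthogonal_group_curve[OF \<gamma>(2)] that by simp
  have o0: "orthogonal_matrix (transpose (\<gamma> 0))" using orth[of 0] by simp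
  have \<gamma>0: "\<gamma> 0 ** transpose (\<gamma> 0) = mat 1" "transpose (\<gamma> 0) ** \<gamma> 0 = mat 1"
    using orth[of 0] by (simp_all add: orthogonal_matrix_def)
  define y where "y t j = transpose (\<gamma> 0) *v (\<gamma> t *v v j)" for t j
  have y0: "y 0 j = v j" for j
    by (simp add: y_def matrix_vector_mul_assoc \<gamma>0 del: transpose_matrix_vector)
  have unit: "norm (\<gamma> t *v v j) = 1" if "t \<in> {0..1}" for t j
    using orth[OF that] orthonormal_frame_norm[OF v] by (simp add: orthogonal_matrix_norm_image)
  have yunit: "norm (y t j) = 1" if "t \<in> {0..1}" for t j
    unfolding y_def using orthogonal_matrix_norm_image[OF o0] unit[OF that] by simp
  have normL: "norm (\<chi> j. \<theta> j) = L"
    unfolding L norm_vec_def L2_set_def by simp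
  have angle01: "angle_vec (\<lambda>j. \<gamma> 0 *v v j) (\<lambda>j. \<gamma> 1 *v v j) = (\<chi> j. \<theta> j)"
    using \<theta> by (simp add: angle_vec_def ends arccos_cos vec_eq_iff)
  have cosy_le: "y a j \<bullet> y b j = cos ((s b - s a) * \<theta> j)" if ab: "0 \<le> a" "a \<le> b" "b \<le> 1" for a b j
  proof -
    let ?x = "(\<gamma> a *v v j) \<bullet> (\<gamma> b *v v j)"
    have "angle_vec (\<lambda>j. \<gamma> a *v v j) (\<lambda>j. \<gamma> b *v v j) = (arc_length \<gamma> a b / L) *\<^sub>R (\<chi> j. \<theta> j)"
      using minimal_curve_angle_vec[OF \<gamma> v angle01 _ ab] len normL by simp
    then have "arccos ?x = (arc_length \<gamma> a b / L) * \<theta> j"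
      by (simp add: angle_vec_def vec_eq_iff)
    moreover have "arc_length \<gamma> a b / L = s b - s a"
      using arc_length_add[OF \<gamma>(1), of 0 a b] ab by (simp add: s_def diff_divide_distrib[symmetric])
    moreover have "\<bar>?x\<bar> \<le> 1"
      using Cauchy_Schwarz_ineq2[of "\<gamma> a *v v j" "\<gamma> b *v v j"] unit[of a j] unit[of b j] ab by simp
    then have "cos (arccos ?x) = ?x" by (intro cos_arccos_abs)
    ultimately show ?thesis
      unfolding y_def orthogonal_matrix_inner[OF o0] by simp
  qed
  have cosy: "y a j \<bullet> y b j = cos ((s b - s a) * \<theta> j)" if "a \<in> {0..1}" "b \<in> {0..1}" for a b j
  proof (cases "a \<le> b")
    case False
    then have "y b j \<bullet> y a j = cos ((s a - s b) * \<theta> j)"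
      using cosy_le[of b a j] that by simp
    also have "(s a - s b) * \<theta> j = - ((s b - s a) * \<theta> j)" by (simp add: algebra_simps)
    finally show ?thesis by (simp only: cos_minus inner_commute)
  qed (use cosy_le that in auto)
  have s0: "s 0 = 0" by (simp add: s_def arc_length_eq)
  have y_eqI: "mexp (s t *\<^sub>R B) *v v j = y t j \<Longrightarrow> mexp (s t *\<^sub>R B) *v v j = (transpose (\<gamma> 0) ** \<gamma> t) *v v j" for B t j
    by (simp add: y_def matrix_vector_mul_assoc del: transpose_matrix_vector)
  have concl: "\<gamma> t = \<gamma> 0 ** mexp (s t *\<^sub>R B)" if "\<And>j. mexp (s t *\<^sub>R B) *v v j = y t j" for B t
  proof -
    have "mexp (s t *\<^sub>R B) = transpose (\<gamma> 0) ** \<gamma> t"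
      by (rule matrix_eq_on_frame[OF v y_eqI]) (rule that)
    then show ?thesis by (simp add: matrix_mul_assoc \<gamma>0)
  qed
  show ?thesis
  proof (cases "L = 0")
    \<comment> \<open>Division by zero makes \<open>s\<close> constantly \<open>0\<close> here, and
      the curve is constant.\<close>
    case True
    then have \<theta>0: "\<theta> j = 0" for j
      using normL by (simp add: vec_eq_iff)
    have "skew_spectrum 0 v \<theta>"
      using v by (simp add: skew_spectrum_def \<theta>0 transpose_def vec_eq_iff)
    moreover have "\<gamma> t = \<gamma> 0 ** mexp ((arc_length \<gamma> 0 t / L) *\<^sub>R 0)" if "t \<in> {0..1}" for t
    proof (rule concl[unfolded s_def])
      fix j
      have "y 0 j \<bullet> y t j = 1" using cosy[of 0 t j] that \<theta>0 by simp
      from unit_inner_one_eq[OF yunit yunit this] have "y 0 j = y t j" using that by simp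
      then show "mexp ((arc_length \<gamma> 0 t / L) *\<^sub>R 0) *v v j = y t j"
        using y0 by (simp add: mexp_0)
    qed
    ultimately show ?thesis using that by blast
  next
    case False
    then have s1: "s 1 = 1" using len by (simp add: s_def)
    have "continuous_on {0..1} s"
      using tame_curve_piecewise_C1[OF piecewise_C1_scaled_arc_length[OF \<gamma>(1)], of L]
      by (simp add: tame_curve_def s_def[abs_def])
    then have surj: "\<exists>t\<in>{0..1}. s t = \<sigma>" if "\<sigma> \<in> {0..1}" for \<sigma>
      using IVT'[of s 0 \<sigma> 1] s0 s1 that by auto
    \<comment> \<open>At half the length the angle from the start is \<open>\<theta> j / 2\<close>,
      at most a right angle, so its sine is non-zero for every \<open>\<theta> j > 0\<close>. The
      end point would fail for \<open>\<theta> j = pi\<close>, being antipodal.\<close>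
    obtain h where h: "h \<in> {0..1}" "s h = 1 / 2" using surj[of "1/2"] by auto
    \<comment> \<open>The unit tangent at \<open>v j\<close> towards the halfway point. For
      \<open>\<theta> j = 0\<close> it occurs below only with factor \<open>0\<close>, and
      \<open>0\<close> is a default.\<close>
    define w where "w j = (if \<theta> j = 0 then 0 else (1 / sin (\<theta> j / 2)) *\<^sub>R (y h j - cos (\<theta> j / 2) *\<^sub>R v j))" for j
    have y: "y t j = cos (s t * \<theta> j) *\<^sub>R v j + sin (s t * \<theta> j) *\<^sub>R w j" if t: "t \<in> {0..1}" for t j
    proof (cases "\<theta> j = 0")
      case True
      then have "y 0 j \<bullet> y t j = 1" using cosy[of 0 t j] t by simp
      from unit_inner_one_eq[OF yunit yunit this] have "y 0 j = y t j" using t by simp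
      then show ?thesis using True y0 by simp
    next
      case nz: False
      have "sin (\<theta> j / 2) \<noteq> 0"
        using \<theta>[of j] nz sin_gt_zero[of "\<theta> j / 2"] pi_gt_zero by force
      moreover have "y 0 j \<bullet> y h j = cos (\<theta> j / 2)" "y 0 j \<bullet> y t j = cos (s t * \<theta> j)"
        using cosy[of 0 h j] cosy[of 0 t j] h t s0 by auto
      moreover have "y h j \<bullet> y t j = cos (\<theta> j / 2 - s t * \<theta> j)"
        using cosy[of h t j] cos_minus[of "\<theta> j / 2 - s t * \<theta> j"] h t by (simp add: algebra_simps)
      ultimately show ?thesis
        using great_circle_point[of "y 0 j" "y h j" "y t j" "\<theta> j / 2" "s t * \<theta> j"] yunit h t nz y0
          orthonormal_frame_norm[OF v]
        by (simp add: w_def)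
    qed
    \<comment> \<open>Since \<open>s\<close> takes every value in \<open>{0..1}\<close>,
      orthogonality along the curve becomes a statement about all \<open>\<sigma>\<close>, which can
      be differentiated even if \<open>\<gamma>\<close> rests or has corners.\<close>
    have frame: "orthonormal_frame (\<lambda>j. cos (\<sigma> * \<theta> j) *\<^sub>R v j + sin (\<sigma> * \<theta> j) *\<^sub>R w j)" if "\<sigma> \<in> {0..1}" for \<sigma>
    proof -
      obtain t where t: "t \<in> {0..1}" "s t = \<sigma>" using surj[OF \<open>\<sigma> \<in> {0..1}\<close>] by blast
      have "orthonormal_frame (y t)"
        using v unfolding orthonormal_frame_def y_def orthogonal_matrix_inner[OF o0] orthogonal_matrix_inner[OF orth[OF t(1)]] .
      then show ?thesis using y[OF t(1)] t(2) by (simp add: orthonormal_frame_def)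
    qed
    define B where "B = frame_matrix v (\<lambda>j. \<theta> j *\<^sub>R w j)"
    have B: "skew_spectrum B v \<theta>"
      unfolding B_def using \<theta> by (intro skew_spectrum_from_circles[OF v _ frame]) auto
    have "\<gamma> t = \<gamma> 0 ** mexp (s t *\<^sub>R B)" if "t \<in> {0..1}" for t
    proof (rule concl)
      show "mexp (s t *\<^sub>R B) *v v j = y t j" for j
        using y[OF that, of j] frame_matrix_apply[OF v, of "\<lambda>j. \<theta> j *\<^sub>R w j" j]
        by (simp add: mexp_skew_spectrum[OF B]) (simp add: B_def)
    qed
    then show ?thesis using B that unfolding s_def by blast
  qed
qed

section \<open>Principal logarithms\<close>

lemma matpow_commute: "matpow B k ** B = B ** matpow B k"
proof (induction k)
  case (Suc k)
  have "matpow B (Suc k) ** B = B ** (matpow B k ** B)"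
    by (simp add: matpow_Suc matrix_mul_assoc)
  then show ?case by (simp only: Suc matpow_Suc)
qed (simp add: matpow_0)

lemma matpow_transpose: "matpow (transpose B) k = transpose (matpow B k)"
proof (induction k)
  case (Suc k)
  have "matpow (transpose B) (Suc k) = transpose (matpow B k ** B)"
    by (simp add: matpow_Suc Suc matrix_transpose_mul)
  then show ?case by (simp only: matpow_commute matpow_Suc)
qed (simp add: matpow_0)

lemma mexp_transpose: "mexp (transpose B) = transpose (mexp B)"
proof -
  have "mexp (transpose B) $ i $ j = mexp B $ j $ i" for i j
    using mexp_entry_sums[of "transpose B" i j 1] mexp_entry_sums[of B j i 1]
    by (simp add: matpow_transpose) (simp add: transpose_def sums_unique2)
  then show ?thesis by (simp add: vec_eq_iff transpose_def)
qed

text \<open>Transposition turns \<open>mexp B\<close> into the exponential of \<open>- B\<close>, so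
  the sine terms cancel. Spectral data of a logarithm thereby yield an angle frame of its
  exponential.\<close>

lemma skew_spectrum_symmetric_part:
  assumes B: "skew_spectrum B v \<theta>"
  shows "(mexp B + transpose (mexp B)) *v v j = (2 * cos (\<theta> j)) *\<^sub>R v j"
proof -
  define q where "q = (sin (\<theta> j) / \<theta> j) *\<^sub>R (B *v v j)"
  have "transpose (mexp B) = mexp ((-1) *\<^sub>R B)"
    using B by (simp add: mexp_transpose[symmetric] skew_spectrum_def)
  then have "transpose (mexp B) *v v j = cos (\<theta> j) *\<^sub>R v j - q"
    using mexp_skew_spectrum[OF B, of "-1" j] by (simp add: q_def del: transpose_matrix_vector)
  moreover have "mexp B *v v j = cos (\<theta> j) *\<^sub>R v j + q"
    using mexp_skew_spectrum[OF B, of 1 j] by (simp add: q_def)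
  ultimately have "(mexp B + transpose (mexp B)) *v v j = cos (\<theta> j) *\<^sub>R v j + cos (\<theta> j) *\<^sub>R v j"
    by (simp only: matrix_vector_mult_add_rdistrib) simp
  then show ?thesis by (simp only: scaleR_2[symmetric] scaleR_scaleR)
qed

text \<open>\<open>B ** B\<close> is symmetric, and by skewness its quadratic form at
  \<open>x\<close> is minus the square of \<open>norm (B *v x)\<close>; this supplies the
  angles.\<close>

lemma skew_matrix_spectrum:
  fixes B :: "real^'n^'n"
  assumes B: "transpose B = - B"
  obtains v \<theta> where "skew_spectrum B v \<theta>"
proof -
  have neg: "(- B) *v x = - (B *v x)" "B *v (- x) = - (B *v x)" for x
    by (simp_all add: vec_eq_iff matrix_vector_mult_def sum_negf)
  have "transpose (B ** B) = B ** B"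
    by (simp add: matrix_transpose_mul B matrix_eq matrix_vector_mul_assoc[symmetric] neg)
  then obtain v :: "'n \<Rightarrow> real^'n" and d where v: "orthonormal_frame v"
    and d: "\<And>j. (B ** B) *v v j = d j *\<^sub>R v j"
    using symmetric_matrix_eigenframe by blast
  have "d j = - (norm (B *v v j))\<^sup>2" for j
  proof -
    have "d j = v j \<bullet> (B *v (B *v v j))"
      using d[of j] orthonormal_frame_inner[OF v, of j j] by (simp add: matrix_vector_mul_assoc)
    then show ?thesis by (simp add: skew_inner[OF B] power2_norm_eq_inner)
  qed
  then have "skew_spectrum B v (\<lambda>j. norm (B *v v j))"
    using B v d by (simp add: skew_spectrum_def matrix_vector_mul_assoc)
  then show ?thesis using that by blast
qed

section \<open>Complex eigenvalues of a real skew matrix\<close>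

definition cvec :: "real^'n \<Rightarrow> complex^'n" where
  "cvec x = (\<chi> i. of_real (x $ i))"

lemma complexify_cvec: "complexify B *v cvec x = cvec (B *v x)"
proof -
  have "(complexify B *v cvec x) $ i = cvec (B *v x) $ i" for i
    by (simp add: cvec_def complexify_def matrix_vector_mult_def)
  then show ?thesis unfolding vec_eq_iff by blast
qed

lemma cvec_scaleR: "cvec (r *\<^sub>R x) = of_real r *s cvec x"
proof -
  have "cvec (r *\<^sub>R x) $ i = (of_real r *s cvec x) $ i" for i
    by (simp add: cvec_def)
  then show ?thesis unfolding vec_eq_iff by blast
qed

text \<open>The square of \<open>?C\<close> plus that of \<open>\<theta> j\<close> factors into
  \<open>?C - \<i> * \<theta> j\<close> and \<open>?C + \<i> * \<theta> j\<close>. Either the second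
  factor kills \<open>?u\<close>, or it maps \<open>?u\<close> to an eigenvector for
  \<open>\<i> * \<theta> j\<close>; the modulus is the same.\<close>

lemma skew_spectrum_eigenvalue:
  fixes B :: "real^'n^'n"
  assumes B: "skew_spectrum B v \<theta>"
  shows "\<exists>z. eigenvalue (complexify B) z \<and> cmod z = \<theta> j"
proof -
  let ?C = "complexify B"
  let ?u = "cvec (v j)"
  have \<theta>: "0 \<le> \<theta> j" and BB: "B *v (B *v v j) = - (\<theta> j)\<^sup>2 *\<^sub>R v j" and v: "orthonormal_frame v"
    using B by (auto simp: skew_spectrum_def)
  have u0: "?u \<noteq> 0"
  proof
    assume "?u = 0"
    then have "v j = 0" by (simp add: cvec_def vec_eq_iff)
    then show False using orthonormal_frame_norm[OF v, of j] by simp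
  qed
  have CC: "?C *v (?C *v ?u) = - (of_real (\<theta> j))\<^sup>2 *s ?u"
    by (simp only: complexify_cvec BB cvec_scaleR) simp
  define w where "w = ?C *v ?u + (\<i> * \<theta> j) *s ?u"
  show ?thesis
  proof (cases "w = 0")
    case True
    then have "?C *v ?u = (- \<i> * \<theta> j) *s ?u"
      by (simp add: w_def add_eq_0_iff vec_eq_iff)
    then show ?thesis
      using u0 \<theta> unfolding eigenvalue_def by (intro exI[of _ "- \<i> * \<theta> j"]) (auto simp: norm_mult)
  next
    case False
    have "?C *v w = ?C *v (?C *v ?u) + (\<i> * \<theta> j) *s (?C *v ?u)"
      by (simp add: w_def matrix_vector_right_distrib vector_scalar_commute)
    also have "\<dots> = (\<i> * \<theta> j) *s w"
      unfolding CC by (simp add: w_def vec_eq_iff distrib_left power2_eq_square mult.assoc[symmetric])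
        (simp add: algebra_simps)
    finally show ?thesis
      using False \<theta> unfolding eigenvalue_def by (intro exI[of _ "\<i> * \<theta> j"]) (auto simp: norm_mult)
  qed
qed

text \<open>Pair the eigenvector bilinearly, without conjugation, with real vectors: under this
  functional \<open>p\<close>, skewness turns \<open>B\<close> into multiplication by
  \<open>- z\<close>. As \<open>p\<close> cannot vanish on a whole frame, \<open>B ** B\<close>
  yields \<open>z\<^sup>2\<close> as minus the square of some \<open>\<theta> j\<close>.\<close>

lemma eigenvalue_skew_spectrum:
  fixes B :: "real^'n^'n"
  assumes B: "skew_spectrum B v \<theta>" and z: "eigenvalue (complexify B) z"
  shows "\<exists>j. cmod z = \<theta> j"
proof -
  have skew: "transpose B = - B" and v: "orthonormal_frame v"
    and BB: "\<And>j. B *v (B *v v j) = - (\<theta> j)\<^sup>2 *\<^sub>R v j" and \<theta>: "\<And>j. 0 \<le> \<theta> j"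
    using B by (auto simp: skew_spectrum_def)
  obtain x where x: "x \<noteq> 0" "complexify B *v x = z *s x"
    using z by (auto simp: eigenvalue_def)
  define p where "p y = (\<Sum>i\<in>UNIV. x $ i * of_real (y $ i))" for y :: "real^'n"
  have entry: "B $ i $ k = - B $ k $ i" for i k
    using arg_cong[OF skew, of "\<lambda>A. A $ k $ i"] by (simp add: transpose_def)
  have pB: "p (B *v y) = - z * p y" for y
  proof -
    have "z * p y = (\<Sum>i\<in>UNIV. (complexify B *v x) $ i * of_real (y $ i))"
      by (simp add: x(2) p_def sum_distrib_left mult.assoc)
    also have "\<dots> = (\<Sum>i\<in>UNIV. \<Sum>k\<in>UNIV. of_real (B $ i $ k) * x $ k * of_real (y $ i))"
      by (simp add: matrix_vector_mult_def complexify_def sum_distrib_right)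
    also have "\<dots> = (\<Sum>k\<in>UNIV. \<Sum>i\<in>UNIV. of_real (- B $ k $ i) * x $ k * of_real (y $ i))"
      by (subst sum.swap) (intro sum.cong refl, subst entry, rule refl)
    also have "\<dots> = - p (B *v y)"
      by (simp add: p_def matrix_vector_mult_def sum_distrib_left sum_negf mult_ac)
    finally show ?thesis by simp
  qed
  have "\<exists>j. p (v j) \<noteq> 0"
  proof (rule ccontr)
    assume "\<not> ?thesis"
    then have p0: "p (v j) = 0" for j by blast
    have "(\<chi> i. Re (x $ i)) = (0 :: real^'n)" "(\<chi> i. Im (x $ i)) = (0 :: real^'n)"
      using arg_cong[OF p0, of Re] arg_cong[OF p0, of Im]
      by (auto intro!: orthonormal_frame_eqI[OF v] simp: p_def inner_vec_def Re_sum Im_sum)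
    then have "x = 0" by (simp add: vec_eq_iff complex_eq_iff)
    then show False using x(1) by simp
  qed
  then obtain j where j: "p (v j) \<noteq> 0" by blast
  have pscale: "p (r *\<^sub>R y) = of_real r * p y" for r y
    by (simp add: p_def sum_distrib_left mult_ac)
  have "p (B *v (B *v v j)) = - (of_real (\<theta> j))\<^sup>2 * p (v j)"
    by (simp only: BB pscale) simp
  then have "(z\<^sup>2 - - (of_real (\<theta> j))\<^sup>2) * p (v j) = 0"
    unfolding pB by (simp add: power2_eq_square algebra_simps)
  then have "z\<^sup>2 = - (of_real (\<theta> j))\<^sup>2"
    using j by (simp only: mult_eq_0_iff right_minus_eq) simp
  then have "cmod (z\<^sup>2) = cmod (- (of_real (\<theta> j))\<^sup>2)" by (rule arg_cong)
  then have "(cmod z)\<^sup>2 = (\<theta> j)\<^sup>2"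
    by (simp only: norm_minus_cancel norm_power norm_of_real power2_abs)
  then have "cmod z = \<theta> j" by (rule power2_eq_imp_eq[OF _ norm_ge_zero \<theta>])
  then show ?thesis by blast
qed

text \<open>Trades the condition on complex eigenvalues for a bound on real data.\<close>

lemma skew_principal_log_iff_spectrum:
  assumes B: "skew_spectrum B v \<theta>"
  shows "skew_principal_log R B \<longleftrightarrow> mexp B = R \<and> (\<forall>j. \<theta> j \<le> pi)"
  using skew_spectrum_eigenvalue[OF B] eigenvalue_skew_spectrum[OF B] B
  unfolding skew_principal_log_def skew_spectrum_def atLeastAtMost_iff by (metis norm_ge_zero)

section \<open>Determinants on connected sets of orthogonal matrices\<close>

lemma continuous_on_det: "continuous_on S (det :: real^'n^'n \<Rightarrow> real)"
  unfolding det_def[abs_def]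
  by (intro continuous_on_sum continuous_on_mult continuous_on_const continuous_on_prod
      continuous_on_component continuous_on_id)

lemma det_constant_on_connected:
  fixes S :: "(real^'n^'n) set"
  assumes "connected S" "S \<subseteq> orthogonal_group" "A \<in> S" "B \<in> S"
  shows "det A = det B"
proof -
  have "det ` S \<subseteq> {1, -1}"
    using assms(2) det_orthogonal_matrix by (auto simp: orthogonal_group_def)
  then have "finite (det ` S)" using finite_subset by blast
  then obtain c where "\<And>x. x \<in> S \<Longrightarrow> det x = c"
    using continuous_finite_range_constant[OF assms(1) continuous_on_det]
    by (auto simp: constant_on_def)
  then show ?thesis using assms(3,4) by simp
qed

text \<open>The path of exponentials of \<open>t *\<^sub>R B\<close> joins \<open>mexp B\<close> to
  the identity inside the orthogonal group.\<close>

lemma det_mexp_skew: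
  fixes B :: "real^'n^'n"
  assumes B: "transpose B = - B"
  shows "det (mexp B) = 1"
proof -
  let ?f = "\<lambda>t. mexp (t *\<^sub>R B)"
  have "continuous_on {0..1} ?f"
    by (rule continuous_on_vector_derivative[OF mexp_has_vector_derivative])
  then have "connected (?f ` {0..1::real})" by (intro connected_continuous_image) auto
  moreover have "?f ` {0..1} \<subseteq> orthogonal_group"
    using orthogonal_mexp[OF B] by (auto simp: orthogonal_group_def)
  moreover have "?f 1 \<in> ?f ` {0..1}" "?f 0 \<in> ?f ` {0..1}" by (intro imageI; simp)+
  ultimately have "det (?f 1) = det (?f 0)" by (rule det_constant_on_connected)
  then show ?thesis by (simp add: mexp_0)
qed

text \<open>A fixed-point-free involution with alternating signs: sending \<open>v j\<close> to
  \<open>\<epsilon> j *\<^sub>R v (\<tau> j)\<close> is then a quarter turn in each plane spanned by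
  a pair.\<close>

lemma even_card_pairing:
  assumes J: "finite J" "even (card J)"
  obtains \<tau> :: "'a \<Rightarrow> 'a" and \<epsilon> :: "'a \<Rightarrow> real"
  where "\<And>j. j \<in> J \<Longrightarrow> \<tau> j \<in> J \<and> \<tau> (\<tau> j) = j \<and> \<epsilon> (\<tau> j) = - \<epsilon> j \<and> \<epsilon> j * \<epsilon> j = 1"
proof -
  obtain A where A: "A \<subseteq> J" "card A = card J div 2"
    using obtain_subset_with_card_n[of "card J div 2" J] by auto
  have "card (J - A) = card A"
    using A J by (simp add: card_Diff_subset finite_subset) presburger
  then obtain f where f: "bij_betw f A (J - A)"
    using finite_same_card_bij[of A "J - A"] finite_subset[OF A(1) J(1)] J(1) by auto
  define \<tau> where "\<tau> j = (if j \<in> A then f j else inv_into A f j)" for j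
  define \<epsilon> :: "'a \<Rightarrow> real" where "\<epsilon> j = (if j \<in> A then 1 else -1)" for j
  have "\<tau> j \<in> J \<and> \<tau> (\<tau> j) = j \<and> \<epsilon> (\<tau> j) = - \<epsilon> j \<and> \<epsilon> j * \<epsilon> j = 1" if "j \<in> J" for j
  proof (cases "j \<in> A")
    case True
    then have "f j \<in> J - A" using f by (auto simp: bij_betw_def)
    then show ?thesis
      using True f by (simp add: \<tau>_def \<epsilon>_def bij_betw_inv_into_left)
  next
    case False
    then have "j \<in> J - A" using that by simp
    then have "inv_into A f j \<in> A" "f (inv_into A f j) = j"
      using f by (auto simp: bij_betw_def inv_into_into f_inv_into_f)
    then show ?thesis using False A by (auto simp: \<tau>_def \<epsilon>_def)
  qed
  then show ?thesis using that by blast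
qed

section \<open>Angle frames and the construction of a principal logarithm\<close>

lemma orthogonal_angle_frame:
  fixes R :: "real^'n^'n"
  assumes R: "orthogonal_matrix R"
  obtains v :: "'n \<Rightarrow> real^'n" and \<theta> where "orthonormal_frame v" "\<And>j. \<theta> j \<in> {0..pi}"
    "\<And>j. (R + transpose R) *v v j = (2 * cos (\<theta> j)) *\<^sub>R v j"
proof -
  have "transpose (R + transpose R) = R + transpose R"
    by (simp add: transpose_def vec_eq_iff)
  then obtain v :: "'n \<Rightarrow> real^'n" and d
    where v: "orthonormal_frame v" and d: "\<And>j. (R + transpose R) *v v j = d j *\<^sub>R v j"
    using symmetric_matrix_eigenframe by blast
  have cos: "cos (arccos (d j / 2)) = d j / 2" for j
  proof (rule cos_arccos_abs)
    have "d j = v j \<bullet> ((R + transpose R) *v v j)"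
      unfolding d using orthonormal_frame_inner[OF v, of j j] by simp
    also have "\<dots> = 2 * (v j \<bullet> (R *v v j))"
      using inner_matrix_transpose[of "v j" R "v j"]
      by (simp add: matrix_vector_mult_add_rdistrib inner_add_right inner_commute del: transpose_matrix_vector)
    finally show "\<bar>d j / 2\<bar> \<le> 1"
      using Cauchy_Schwarz_ineq2[of "v j" "R *v v j"] orthonormal_frame_norm[OF v, of j]
      by (simp add: orthogonal_matrix_norm_image[OF R])
  qed
  show ?thesis
  proof (rule that[OF v])
    show "arccos (d j / 2) \<in> {0..pi}" for j
    proof -
      have "\<bar>d j / 2\<bar> \<le> 1" using cos[of j] abs_cos_le_one by metis
      then show ?thesis by (auto simp: abs_le_iff intro!: arccos_lbound arccos_ubound)
    qed
    show "(R + transpose R) *v v j = (2 * cos (arccos (d j / 2))) *\<^sub>R v j" for j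
      unfolding cos d by simp
  qed
qed

locale angle_frame =
  fixes R :: "real^'n^'n" and v :: "'n \<Rightarrow> real^'n" and \<theta> :: "'n \<Rightarrow> real"
  assumes R: "orthogonal_matrix R" and v: "orthonormal_frame v" and \<theta>: "\<And>j. \<theta> j \<in> {0..pi}"
    and sym: "\<And>j. (R + transpose R) *v v j = (2 * cos (\<theta> j)) *\<^sub>R v j"
begin

lemma inner_add_swap: "v i \<bullet> (R *v v j) + v j \<bullet> (R *v v i) = (if i = j then 2 * cos (\<theta> j) else 0)"
proof -
  have "v i \<bullet> (R *v v j) + v j \<bullet> (R *v v i) = v i \<bullet> ((R + transpose R) *v v j)"
    using inner_matrix_transpose[of "v j" R "v i"]
    by (simp add: matrix_vector_mult_add_rdistrib inner_add_right inner_commute del: transpose_matrix_vector)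
  then show ?thesis unfolding sym using orthonormal_frame_inner[OF v, of i j] by simp
qed

lemma inner_image: "v j \<bullet> (R *v v j) = cos (\<theta> j)"
  using inner_add_swap[of j j] by simp

text \<open>\<open>R\<close> commutes with \<open>R + transpose R\<close> and so preserves its
  eigenspaces; on \<open>{0..pi}\<close> the cosine determines the angle.\<close>

lemma inner_image_nonzero:
  assumes "v i \<bullet> (R *v v j) \<noteq> 0"
  shows "\<theta> i = \<theta> j"
proof -
  let ?M = "R + transpose R"
  have "R ** ?M = ?M ** R"
    using R by (simp add: matrix_add_ldistrib matrix_mult_add_left orthogonal_matrix_def)
  then have "R *v (?M *v v j) = ?M *v (R *v v j)"
    by (simp only: matrix_vector_mul_assoc)
  then have "v i \<bullet> (R *v (?M *v v j)) = (transpose ?M *v v i) \<bullet> (R *v v j)"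
    by (simp only: inner_matrix_transpose[of "v i" ?M])
  moreover have "transpose ?M = ?M" by (simp add: transpose_def vec_eq_iff)
  ultimately have "2 * cos (\<theta> j) * (v i \<bullet> (R *v v j)) = 2 * cos (\<theta> i) * (v i \<bullet> (R *v v j))"
    by (simp only: sym matrix_vector_mult_scaleR inner_scaleR_left inner_scaleR_right)
  then have "cos (\<theta> i) = cos (\<theta> j)" using assms by simp
  then show ?thesis using \<theta>[of i] \<theta>[of j] cos_inj_pi[of "\<theta> i" "\<theta> j"] by auto
qed

text \<open>The skew part of \<open>R\<close> applied to \<open>v j\<close>, because the symmetric
  part multiplies \<open>v j\<close> by \<open>cos (\<theta> j)\<close>.\<close>

definition skew_image :: "'n \<Rightarrow> real^'n" where
  "skew_image j = R *v v j - cos (\<theta> j) *\<^sub>R v j"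

lemma image_eq: "R *v v j = cos (\<theta> j) *\<^sub>R v j + skew_image j"
  by (simp add: skew_image_def)

lemma inner_skew_image: "v i \<bullet> skew_image j = v i \<bullet> (R *v v j) - (if i = j then cos (\<theta> j) else 0)"
  using orthonormal_frame_inner[OF v, of i j] by (simp add: skew_image_def inner_diff_right)

lemma skew_image_skew: "v i \<bullet> skew_image j = - (v j \<bullet> skew_image i)"
proof (cases "i = j")
  case True
  then show ?thesis using inner_image[of j] by (simp add: inner_skew_image)
next
  case False
  then show ?thesis using inner_add_swap[of i j] unfolding inner_skew_image by simp
qed

lemma skew_image_nonzero:
  assumes "v i \<bullet> skew_image j \<noteq> 0"
  shows "\<theta> i = \<theta> j"
proof (cases "i = j")
  case False
  then show ?thesis using assms inner_skew_image[of i j] inner_image_nonzero[of i j] by simp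
qed simp

text \<open>For distinct indices the cross terms combine to \<open>v i \<bullet> (R *v v j)\<close>
  times a difference of cosines, and one of these two factors is \<open>0\<close>.\<close>

lemma skew_image_gram: "skew_image i \<bullet> skew_image j = (if i = j then (sin (\<theta> i))\<^sup>2 else 0)"
proof -
  have "skew_image i \<bullet> skew_image j = (R *v v i) \<bullet> (R *v v j) - cos (\<theta> j) * (v j \<bullet> (R *v v i))
      - cos (\<theta> i) * (v i \<bullet> (R *v v j)) + cos (\<theta> i) * cos (\<theta> j) * (v i \<bullet> v j)"
    unfolding skew_image_def inner_diff_left inner_diff_right inner_scaleR_left inner_scaleR_right
      inner_commute[of "R *v v i" "v j"] by (simp add: right_diff_distrib)
  also have "\<dots> = (if i = j then (sin (\<theta> i))\<^sup>2 else 0)"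
  proof (cases "i = j")
    case True
    then show ?thesis
      using inner_image[of j] orthonormal_frame_inner[OF v, of j j]
      by (simp add: orthogonal_matrix_inner[OF R] sin_squared_eq) (simp add: power2_eq_square)
  next
    case False
    then have "v j \<bullet> (R *v v i) = - (v i \<bullet> (R *v v j))"
      using inner_add_swap[of i j] by simp
    then show ?thesis
      using False inner_image_nonzero[of i j] orthonormal_frame_inner[OF v, of i j]
      by (cases "v i \<bullet> (R *v v j) = 0") (simp_all add: orthogonal_matrix_inner[OF R])
  qed
  finally show ?thesis .
qed

lemma skew_image_eq_0: "sin (\<theta> j) = 0 \<Longrightarrow> skew_image j = 0"
  using skew_image_gram[of j j] by simp

text \<open>On a plane rotated by \<open>\<theta> j\<close> the logarithm is this multiple of the
  skew part of \<open>R\<close>. At \<open>0\<close> and \<open>pi\<close> the value is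
  \<open>0\<close> by division by zero, and \<open>skew_image j\<close> vanishes there
  anyway.\<close>

definition log_ratio :: "'n \<Rightarrow> real" where
  "log_ratio j = \<theta> j / sin (\<theta> j)"

lemma scaled_skew_image_skew: "v i \<bullet> (log_ratio j *\<^sub>R skew_image j) = - (v j \<bullet> (log_ratio i *\<^sub>R skew_image i))"
proof (cases "v i \<bullet> skew_image j = 0")
  case True
  then show ?thesis using skew_image_skew[of i j] by simp
next
  case False
  from skew_image_nonzero[OF this] have "log_ratio i = log_ratio j" by (simp add: log_ratio_def)
  then show ?thesis using skew_image_skew[of i j] by simp
qed

lemma sin_eq_0: "sin (\<theta> j) = 0 \<longleftrightarrow> \<theta> j = 0 \<or> \<theta> j = pi"
  using \<theta>[of j] sin_gt_zero[of "\<theta> j"] by force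

text \<open>The lengths come out right except at \<open>pi\<close>, where the skew part of
  \<open>R\<close> vanishes and no multiple of it can have length \<open>pi\<close>. This gap is the
  obstruction to taking a logarithm.\<close>

lemma scaled_skew_image_gram:
  "(log_ratio i *\<^sub>R skew_image i) \<bullet> (log_ratio j *\<^sub>R skew_image j) = (if i = j then (if \<theta> i = pi then 0 else \<theta> i)\<^sup>2 else 0)"
proof (cases "sin (\<theta> i) = 0")
  case True
  then show ?thesis using sin_eq_0[of i] by (auto simp: skew_image_eq_0)
next
  case False
  then have "\<theta> i \<noteq> pi" by auto
  then show ?thesis using False by (cases "i = j") (simp_all add: skew_image_gram log_ratio_def power2_eq_square)
qed

lemma sin_log_ratio: "\<theta> j \<noteq> pi \<Longrightarrow> (sin (\<theta> j) / \<theta> j) *\<^sub>R (log_ratio j *\<^sub>R skew_image j) = skew_image j"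
  using sin_eq_0[of j] skew_image_eq_0[of j] by (cases "sin (\<theta> j) = 0") (auto simp: log_ratio_def)

definition reflected :: "'n set" where
  "reflected = {j. \<theta> j = pi}"

lemma skew_image_reflected: "j \<in> reflected \<Longrightarrow> skew_image j = 0" "j \<in> reflected \<Longrightarrow> v j \<bullet> skew_image i = 0"
proof -
  show *: "skew_image j = 0" if "j \<in> reflected" for j using that by (simp add: reflected_def skew_image_eq_0)
  show "v j \<bullet> skew_image i = 0" if "j \<in> reflected" using *[OF that] skew_image_skew[of j i] by simp
qed

text \<open>\<open>R\<close> is the exponential of a skew matrix times the reflection in the eigenspace of
  eigenvalue \<open>-1\<close>, so its determinant is \<open>-1\<close> to the dimension of that eigenspace.\<close>

lemma det_eq: "det R = (-1) ^ card reflected"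
proof -
  define C where "C = frame_matrix v (\<lambda>j. log_ratio j *\<^sub>R skew_image j)"
  \<comment> \<open>\<open>C\<close> annihilates the frame vectors in \<open>reflected\<close>,
    hence the angle \<open>0\<close> there; the missing sign is supplied by
    \<open>S\<close>.\<close>
  define \<theta>' where "\<theta>' j = (if \<theta> j = pi then 0 else \<theta> j)" for j
  have C: "skew_spectrum C v \<theta>'"
    unfolding C_def
  proof (rule skew_spectrum_frame_matrix[OF v _ scaled_skew_image_skew])
    show "0 \<le> \<theta>' j" for j using \<theta>[of j] by (simp add: \<theta>'_def)
    show "(log_ratio i *\<^sub>R skew_image i) \<bullet> (log_ratio j *\<^sub>R skew_image j) = (if i = j then (\<theta>' i)\<^sup>2 else 0)" for i j
      unfolding scaled_skew_image_gram \<theta>'_def by simp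
  qed
  define e :: "'n \<Rightarrow> real" where "e j = (if j \<in> reflected then -1 else 1)" for j
  define S where "S = frame_matrix v (\<lambda>j. e j *\<^sub>R v j)"
  have S: "S *v v j = e j *\<^sub>R v j" for j
    unfolding S_def by (rule frame_matrix_apply[OF v])
  have "R = mexp C ** S"
  proof (rule matrix_eq_on_frame[OF v])
    fix j
    have mC: "mexp C *v v j = cos (\<theta>' j) *\<^sub>R v j + (sin (\<theta>' j) / \<theta>' j) *\<^sub>R (log_ratio j *\<^sub>R skew_image j)"
      using mexp_skew_spectrum[OF C, of 1 j] frame_matrix_apply[OF v, of "\<lambda>j. log_ratio j *\<^sub>R skew_image j" j]
      by (simp add: C_def)
    have "(mexp C ** S) *v v j = e j *\<^sub>R (mexp C *v v j)"
      by (simp add: matrix_vector_mul_assoc[symmetric] S matrix_vector_mult_scaleR)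
    also have "\<dots> = R *v v j"
    proof (cases "j \<in> reflected")
      case True
      then show ?thesis unfolding mC image_eq by (simp add: e_def \<theta>'_def skew_image_reflected reflected_def)
    next
      case False
      then have "\<theta> j \<noteq> pi" by (simp add: reflected_def)
      then show ?thesis
        unfolding mC image_eq using False sin_log_ratio[of j] by (simp add: e_def \<theta>'_def)
    qed
    finally show "R *v v j = (mexp C ** S) *v v j" by simp
  qed
  then have "det R = det (mexp C) * det S" by (simp add: det_mul)
  also have "det (mexp C) = 1" using C by (intro det_mexp_skew) (simp add: skew_spectrum_def)
  also have "det S = (\<Prod>j\<in>UNIV. e j)"
  proof -
    define D :: "real^'n^'n" where "D = (\<chi> i j. if i = j then e j else 0)"
    let ?P = "frame_cols v"
    have "S ** ?P = ?P ** D"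
      unfolding mult_frame_cols S
      by (simp add: vec_eq_iff frame_cols_def D_def matrix_matrix_mult_def if_distrib mult.commute cong: if_cong)
    then have "det S * det ?P = det ?P * det D" by (metis det_mul)
    moreover have "det ?P \<noteq> 0"
      using det_orthogonal_matrix[OF orthogonal_frame_cols[OF v]] by auto
    moreover have "det D = (\<Prod>j\<in>UNIV. e j)"
      by (subst det_diagonal) (simp_all add: D_def)
    ultimately show ?thesis by simp
  qed
  also have "(\<Prod>j\<in>UNIV. e j) = (-1) ^ card reflected"
    unfolding e_def by (simp add: prod.If_cases)
  finally show ?thesis by simp
qed

text \<open>Outside the eigenspace of -1 the rescaled skew part of \<open>R\<close> is a logarithm.
  On that eigenspace, of even dimension because \<open>det R = 1\<close>, \<open>pi\<close> times a
  quarter turn in each paired plane has exponential -1.\<close>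

lemma principal_log_exists:
  assumes "det R = 1"
  shows "\<exists>B. skew_principal_log R B"
proof -
  have "even (card reflected)"
    using assms det_eq by (cases "even (card reflected)") auto
  then obtain \<tau> \<epsilon> where \<tau>: "\<And>j. j \<in> reflected \<Longrightarrow> \<tau> j \<in> reflected" "\<And>j. j \<in> reflected \<Longrightarrow> \<tau> (\<tau> j) = j"
    and \<epsilon>: "\<And>j. j \<in> reflected \<Longrightarrow> \<epsilon> (\<tau> j) = - \<epsilon> j" "\<And>j. j \<in> reflected \<Longrightarrow> \<epsilon> j * \<epsilon> j = (1::real)"
    using even_card_pairing[of reflected] by (metis finite)
  define w where "w j = (if j \<in> reflected then (pi * \<epsilon> j) *\<^sub>R v (\<tau> j) else log_ratio j *\<^sub>R skew_image j)" for j
  define B where "B = frame_matrix v w"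
  note vv = orthonormal_frame_inner[OF v]
  have skew: "v i \<bullet> w j = - (v j \<bullet> w i)" for i j
  proof (cases "i \<in> reflected"; cases "j \<in> reflected")
    assume ij: "i \<in> reflected" "j \<in> reflected"
    then have "i = \<tau> j \<longleftrightarrow> j = \<tau> i" using \<tau> by metis
    then show ?thesis using ij \<epsilon> by (auto simp: w_def vv)
  next
    assume ij: "i \<in> reflected" "j \<notin> reflected"
    then have "\<tau> i \<noteq> j" using \<tau> by metis
    then show ?thesis using ij by (simp add: w_def vv skew_image_reflected)
  next
    assume ij: "i \<notin> reflected" "j \<in> reflected"
    then have "\<tau> j \<noteq> i" using \<tau> by metis
    then show ?thesis using ij by (simp add: w_def vv skew_image_reflected)
  next
    assume "i \<notin> reflected" "j \<notin> reflected"
    then show ?thesis using scaled_skew_image_skew[of i j] by (simp add: w_def)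
  qed
  have gram: "w i \<bullet> w j = (if i = j then (\<theta> i)\<^sup>2 else 0)" for i j
  proof (cases "i \<in> reflected"; cases "j \<in> reflected")
    assume ij: "i \<in> reflected" "j \<in> reflected"
    then have "\<tau> i = \<tau> j \<longleftrightarrow> i = j" using \<tau> by metis
    then show ?thesis
      using ij \<epsilon>(2)[of j] by (auto simp: w_def vv reflected_def power2_eq_square)
  next
    assume ij: "i \<in> reflected" "j \<notin> reflected"
    then show ?thesis using skew_image_reflected(2)[OF \<tau>(1)] by (auto simp: w_def)
  next
    assume ij: "i \<notin> reflected" "j \<in> reflected"
    then show ?thesis using skew_image_reflected(2)[OF \<tau>(1)] by (auto simp: w_def inner_commute)
  next
    assume "i \<notin> reflected" "j \<notin> reflected"
    then show ?thesis using scaled_skew_image_gram[of i j] by (simp add: w_def reflected_def)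
  qed
  have B: "skew_spectrum B v \<theta>"
    unfolding B_def using \<theta> by (intro skew_spectrum_frame_matrix[OF v _ skew gram]) auto
  have "mexp B = R"
  proof (rule matrix_eq_on_frame[OF v])
    fix j
    have "mexp B *v v j = cos (\<theta> j) *\<^sub>R v j + (sin (\<theta> j) / \<theta> j) *\<^sub>R w j"
      using mexp_skew_spectrum[OF B, of 1 j] frame_matrix_apply[OF v, of w j]
      by (simp add: B_def)
    also have "\<dots> = R *v v j"
      unfolding image_eq using sin_log_ratio[of j] skew_image_reflected(1)[of j] by (cases "j \<in> reflected") (auto simp: w_def reflected_def)
    finally show "mexp B *v v j = R *v v j" .
  qed
  then show ?thesis
    using skew_principal_log_iff_spectrum[OF B] \<theta> by auto
qed

text \<open>The spectral data of \<open>B\<close> provide a second angle frame of \<open>R\<close>,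
  and the sum over eigenvalues does not depend on the frame.\<close>

lemma norm_principal_log:
  assumes "skew_principal_log R B"
  shows "norm B = sqrt (\<Sum>j\<in>UNIV. (\<theta> j)\<^sup>2)"
proof -
  obtain u \<beta> where B: "skew_spectrum B u \<beta>"
    using assms skew_matrix_spectrum unfolding skew_principal_log_def by blast
  then have B': "mexp B = R" "\<And>j. \<beta> j \<le> pi" "\<And>j. 0 \<le> \<beta> j" "orthonormal_frame u"
    using assms skew_principal_log_iff_spectrum[OF B] by (auto simp: skew_spectrum_def)
  have "(\<Sum>j\<in>UNIV. (\<beta> j)\<^sup>2) = (\<Sum>j\<in>UNIV. (\<theta> j)\<^sup>2)"
    using sum_Ln_eigenvalues[OF R B'(4) skew_spectrum_symmetric_part[OF B, unfolded B'(1)]]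
      sum_Ln_eigenvalues[OF R v sym \<theta>] B' by simp
  then show ?thesis by (simp add: skew_spectrum_norm_matrix[OF B])
qed

end

section \<open>Principal geodesic arcs\<close>

lemma matrix_inv_orthogonal:
  assumes "orthogonal_matrix (G :: real^'n^'n)"
  shows "matrix_inv G = transpose G"
proof -
  have G: "transpose G ** G = mat 1" "G ** transpose G = mat 1"
    using assms by (auto simp: orthogonal_matrix_def)
  then have "G ** matrix_inv G = mat 1 \<and> matrix_inv G ** G = mat 1"
    unfolding matrix_inv_def by (intro someI[of "\<lambda>A. G ** A = mat 1 \<and> A ** G = mat 1"]) simp
  then have "matrix_inv G ** G ** transpose G = transpose G" by simp
  then show ?thesis by (simp add: matrix_mul_assoc[symmetric] G)
qed

text \<open>Bi-invariance gives the velocity of the geodesic the constant norm of \<open>B\<close>.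
  The reparametrisation is included so that one statement covers arcs and all minimal
  curves.\<close>

lemma skew_geodesic:
  fixes G B :: "real^'n^'n"
  assumes G: "orthogonal_matrix G" and B: "transpose B = - B" and GH: "G ** mexp B = H"
    and s: "reparametrization s" and \<gamma>: "\<And>t. t \<in> {0..1} \<Longrightarrow> \<gamma> t = G ** mexp (s t *\<^sub>R B)"
  shows "curve_joining G H \<gamma>"
    and "0 \<le> a \<Longrightarrow> a \<le> b \<Longrightarrow> b \<le> 1 \<Longrightarrow> arc_length \<gamma> a b = norm B * (s b - s a)"
proof -
  define E where "E x = G ** mexp (x *\<^sub>R B)" for x
  define E' where "E' x = G ** (B ** mexp (x *\<^sub>R B))" for x
  have der: "(E has_vector_derivative E' x) (at x)" for x
    unfolding E_def E'_def
    by (rule bounded_linear.has_vector_derivative[OF bounded_linear_matrix_mult_left mexp_has_vector_derivative])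
  have "continuous_on UNIV (\<lambda>x. mexp (x *\<^sub>R B))"
    by (rule continuous_on_vector_derivative[OF mexp_has_vector_derivative])
  then have cont: "continuous_on UNIV E'"
    unfolding E'_def by (intro bounded_linear.continuous_on[OF bounded_linear_matrix_mult_left])
  have norm: "norm (E' x) = norm B" for x
    by (simp add: E'_def norm_orthogonal_mult[OF G] norm_mult_orthogonal[OF orthogonal_mexp[OF B]])
  have s': "piecewise_C1 s" "mono_on {0..1} s" "s 0 = 0" "s 1 = 1"
    using s by (auto simp: reparametrization_def)
  have eq: "\<gamma> t = E (s t)" if "t \<in> {0..1}" for t
    using \<gamma>[OF that] by (simp add: E_def)
  have "piecewise_C1 \<gamma>"
    by (rule piecewise_C1_smooth_compose[OF s'(1) der cont eq])
  moreover have "\<gamma> ` {0..1} \<subseteq> orthogonal_group"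
    unfolding image_subset_iff orthogonal_group_def
    by (simp add: \<gamma> orthogonal_matrix_mul[OF G orthogonal_mexp[OF B]])
  moreover have "\<gamma> 0 = G" "\<gamma> 1 = H"
    using \<gamma>[of 0] \<gamma>[of 1] s' GH by (simp_all add: mexp_0)
  ultimately show "curve_joining G H \<gamma>"
    unfolding curve_joining_def by blast
  show "arc_length \<gamma> a b = norm B * (s b - s a)" if "0 \<le> a" "a \<le> b" "b \<le> 1"
    by (rule arc_length_smooth_compose[OF s'(1,2) der norm eq that])
qed

lemma reparametrization_id: "reparametrization (\<lambda>t. t)"
proof -
  have "piecewise_C1 (\<lambda>t::real. t)"
    unfolding piecewise_C1_def C1_on_interval_def
    by (intro exI[of _ real] exI[of _ 1] conjI allI impI exI[of _ "\<lambda>_. 1"])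
      (auto intro: has_vector_derivative_id)
  then show ?thesis by (simp add: reparametrization_def mono_on_def)
qed

lemma reparametrization_arc_length:
  assumes "piecewise_C1 \<gamma>" "curve_length \<gamma> = L" "L > 0"
  shows "reparametrization (\<lambda>t. arc_length \<gamma> 0 t / L)"
  unfolding reparametrization_def
proof (intro conjI)
  show "piecewise_C1 (\<lambda>t. arc_length \<gamma> 0 t / L)"
    by (rule piecewise_C1_scaled_arc_length[OF assms(1)])
  show "mono_on {0..1} (\<lambda>t. arc_length \<gamma> 0 t / L)"
  proof (rule mono_onI)
    fix r t :: real assume "r \<in> {0..1}" "t \<in> {0..1}" "r \<le> t"
    then show "arc_length \<gamma> 0 r / L \<le> arc_length \<gamma> 0 t / L"
      using arc_length_add[OF assms(1), of 0 r t] arc_length_nonneg[OF assms(1), of r t] assms(3)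
      by (intro divide_right_mono) auto
  qed
qed (use assms in \<open>simp_all add: arc_length_eq curve_length_def\<close>)

theorem theorem4p11:
  fixes G H :: "real^'n^'n"
  assumes "connected_component orthogonal_group G H"
  shows "(\<forall>\<gamma>. minimal_curve G H \<gamma> \<longleftrightarrow>
            (\<exists>\<alpha> s. principal_geodesic_arc G H \<alpha> \<and> reparametrization s \<and>
                   (\<forall>t\<in>{0..1}. \<gamma> t = \<alpha> (s t))))
       \<and> (\<forall>\<gamma>. minimal_curve G H \<gamma> \<and> const_speed \<gamma> \<longleftrightarrow> principal_geodesic_arc G H \<gamma>)
       \<and> riem_dist G H =
            sqrt (\<Sum>\<mu>\<in>#eigenvalues (complexify (matrix_inv G ** H)). (cmod (Ln \<mu>))\<^sup>2)"
proof -
  obtain T where T: "connected T" "T \<subseteq> orthogonal_group" "G \<in> T" "H \<in> T"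
    using assms unfolding connected_component_def by blast
  then have G: "orthogonal_matrix G" and H: "orthogonal_matrix H"
    by (auto simp: orthogonal_group_def)
  have GG: "transpose G ** G = mat 1" "G ** transpose G = mat 1"
    using G by (auto simp: orthogonal_matrix_def)
  define R where "R = transpose G ** H"
  have GR: "G ** R = H" by (simp add: R_def matrix_mul_assoc GG)
  have invG: "matrix_inv G ** H = R"
    by (simp add: R_def matrix_inv_orthogonal[OF G])
  have R: "orthogonal_matrix R"
    unfolding R_def using G H by (simp add: orthogonal_matrix_mul)
  have "det R = det G * det G"
    using det_constant_on_connected[OF T] by (simp add: R_def det_mul)
  then have detR: "det R = 1"
    using det_orthogonal_matrix[OF G] by auto
  obtain v :: "'n \<Rightarrow> real^'n" and \<theta> where v: "orthonormal_frame v" and \<theta>: "\<And>j. \<theta> j \<in> {0..pi}"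
    and sym: "\<And>j. (R + transpose R) *v v j = (2 * cos (\<theta> j)) *\<^sub>R v j"
    using orthogonal_angle_frame[OF R] by blast
  interpret angle_frame R v \<theta>
    by unfold_locales (fact R v \<theta> sym)+
  define L where "L = sqrt (\<Sum>j\<in>UNIV. (\<theta> j)\<^sup>2)"
  have "L \<ge> 0" by (simp add: L_def sum_nonneg)
  have eig: "sqrt (\<Sum>\<mu>\<in>#eigenvalues (complexify (matrix_inv G ** H)). (cmod (Ln \<mu>))\<^sup>2) = L"
    unfolding invG L_def using sum_Ln_eigenvalues[OF R v sym \<theta>] by simp
  have log_norm: "norm B = L" if "skew_principal_log R B" for B
    using norm_principal_log[OF that] by (simp add: L_def)
  have ends: "(G *v v j) \<bullet> (H *v v j) = cos (\<theta> j)" for j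
    using inner_image[of j] inner_matrix_transpose[of "v j" "transpose G" "H *v v j"]
    by (simp add: R_def matrix_vector_mul_assoc[symmetric] del: transpose_matrix_vector)
  have lower: "L \<le> curve_length \<delta>" if "curve_joining G H \<delta>" for \<delta>
  proof -
    have \<delta>: "piecewise_C1 \<delta>" "\<delta> ` {0..1} \<subseteq> orthogonal_group" "\<delta> 0 = G" "\<delta> 1 = H"
      using that by (auto simp: curve_joining_def)
    have "angle_vec (\<lambda>j. \<delta> 0 *v v j) (\<lambda>j. \<delta> 1 *v v j) = (\<chi> j. \<theta> j)"
      using \<theta> by (simp add: \<delta> angle_vec_def ends arccos_cos vec_eq_iff)
    moreover have "norm (\<chi> j. \<theta> j) = L"
      unfolding L_def norm_vec_def L2_set_def by simp
    ultimately show ?thesis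
      using angle_vec_le_curve_length[OF \<delta>(1,2) v, of 0 1] by (simp add: curve_length_def)
  qed
  have log_curve: "curve_joining G H \<gamma>" "0 \<le> a \<Longrightarrow> a \<le> b \<Longrightarrow> b \<le> 1 \<Longrightarrow> arc_length \<gamma> a b = L * (s b - s a)"
    if "skew_principal_log R B" "reparametrization s" "\<And>t. t \<in> {0..1} \<Longrightarrow> \<gamma> t = G ** mexp (s t *\<^sub>R B)"
    for B s \<gamma> a b
  proof -
    have B: "transpose B = - B" "G ** mexp B = H"
      using that(1) GR by (auto simp: skew_principal_log_def)
    show "curve_joining G H \<gamma>" by (rule skew_geodesic(1)[OF G B that(2,3)])
    show "arc_length \<gamma> a b = L * (s b - s a)" if "0 \<le> a" "a \<le> b" "b \<le> 1"
      using skew_geodesic(2)[OF G B \<open>reparametrization s\<close> _ that, of \<gamma>]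
        \<open>\<And>t. t \<in> {0..1} \<Longrightarrow> \<gamma> t = G ** mexp (s t *\<^sub>R B)\<close> log_norm[OF \<open>skew_principal_log R B\<close>] by simp
  qed
  have arc_iff: "principal_geodesic_arc G H \<alpha> \<longleftrightarrow>
      (\<exists>B. skew_principal_log R B \<and> (\<forall>t\<in>{0..1}. \<alpha> t = G ** mexp (t *\<^sub>R B)))" for \<alpha>
    unfolding principal_geodesic_arc_def invG ..
  \<comment> \<open>The arc of one principal logarithm attains the lower bound, so minimality comes
    to mean length \<open>L\<close>, and the distance is a minimum.\<close>
  obtain B0 where B0: "skew_principal_log R B0" using principal_log_exists[OF detR] by blast
  define \<gamma>0 where "\<gamma>0 t = G ** mexp (t *\<^sub>R B0)" for t
  have \<gamma>0: "curve_joining G H \<gamma>0" "curve_length \<gamma>0 = L"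
    using log_curve(1)[OF B0 reparametrization_id, of \<gamma>0]
      log_curve(2)[OF B0 reparametrization_id, of \<gamma>0 0 1] by (simp_all add: \<gamma>0_def curve_length_def)
  have min_iff: "minimal_curve G H \<gamma> \<longleftrightarrow> curve_joining G H \<gamma> \<and> curve_length \<gamma> = L" for \<gamma>
    using \<gamma>0 lower unfolding minimal_curve_def by (metis order_antisym)
  have min_form: "\<exists>B s. skew_principal_log R B \<and> reparametrization s \<and> (\<forall>t\<in>{0..1}. \<gamma> t = G ** mexp (s t *\<^sub>R B))"
    if min: "minimal_curve G H \<gamma>" for \<gamma>
  proof -
    have \<gamma>: "piecewise_C1 \<gamma>" "\<gamma> ` {0..1} \<subseteq> orthogonal_group" "\<gamma> 0 = G" "\<gamma> 1 = H" "curve_length \<gamma> = L"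
      using min unfolding min_iff curve_joining_def by auto
    have ends': "(\<gamma> 0 *v v j) \<bullet> (\<gamma> 1 *v v j) = cos (\<theta> j)" for j
      by (simp add: \<gamma> ends)
    obtain B where B: "skew_spectrum B v \<theta>"
      and form: "\<And>t. t \<in> {0..1} \<Longrightarrow> \<gamma> t = \<gamma> 0 ** mexp ((arc_length \<gamma> 0 t / L) *\<^sub>R B)"
      using minimal_length_rigidity[OF \<gamma>(1,2) v \<theta> ends' L_def] \<gamma>(5) unfolding curve_length_def by blast
    have "\<exists>s. reparametrization s \<and> (\<forall>t\<in>{0..1}. \<gamma> t = G ** mexp (s t *\<^sub>R B))"
    \<comment> \<open>Arc length cannot be normalised when \<open>L = 0\<close>; then
      \<open>B = 0\<close> and the identity will do as reparametrisation.\<close>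
    proof (cases "L = 0")
      case True
      then have "B = 0" using skew_spectrum_norm_matrix[OF B] by (simp add: L_def)
      then show ?thesis using form \<gamma>(3) reparametrization_id by auto
    next
      case False
      then show ?thesis
        using form \<gamma>(3) reparametrization_arc_length[OF \<gamma>(1,5)] \<open>L \<ge> 0\<close> by auto
    qed
    then obtain s where s: "reparametrization s" "\<And>t. t \<in> {0..1} \<Longrightarrow> \<gamma> t = G ** mexp (s t *\<^sub>R B)"
      by blast
    \<comment> \<open>Rigidity yields \<open>B\<close> without relating it to \<open>R\<close>; the
      end point \<open>H\<close> makes it a logarithm of \<open>R\<close>.\<close>
    have "transpose G ** \<gamma> 1 = transpose G ** G ** mexp B"
      using s(2)[of 1] s(1) by (simp add: reparametrization_def matrix_mul_assoc)
    then have "mexp B = R" by (simp add: GG \<gamma>(4) R_def)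
    then have "skew_principal_log R B"
      using skew_principal_log_iff_spectrum[OF B] \<theta> by auto
    then show ?thesis using s by blast
  qed
  have "minimal_curve G H \<gamma> \<longleftrightarrow> (\<exists>\<alpha> s. principal_geodesic_arc G H \<alpha> \<and> reparametrization s \<and>
      (\<forall>t\<in>{0..1}. \<gamma> t = \<alpha> (s t)))" (is "_ \<longleftrightarrow> ?rhs") for \<gamma>
  proof
    assume "minimal_curve G H \<gamma>"
    from min_form[OF this] obtain B s where Bs: "skew_principal_log R B" "reparametrization s"
      "\<forall>t\<in>{0..1}. \<gamma> t = G ** mexp (s t *\<^sub>R B)" by blast
    then have "principal_geodesic_arc G H (\<lambda>t. G ** mexp (t *\<^sub>R B))"
      unfolding arc_iff by blast
    then show ?rhs using Bs by (intro exI[of _ "\<lambda>t. G ** mexp (t *\<^sub>R B)"] exI[of _ s]) simp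
  next
    assume ?rhs
    then obtain \<alpha> s B where s: "reparametrization s" and B: "skew_principal_log R B"
      and \<alpha>: "\<And>t. t \<in> {0..1} \<Longrightarrow> \<alpha> t = G ** mexp (t *\<^sub>R B)" and \<gamma>: "\<And>t. t \<in> {0..1} \<Longrightarrow> \<gamma> t = \<alpha> (s t)"
      unfolding arc_iff by blast
    \<comment> \<open>The arc \<open>\<alpha>\<close> is prescribed only on \<open>{0..1}\<close>,
      so \<open>s\<close> must not leave it.\<close>
    have "s t \<in> {0..1}" if "t \<in> {0..1}" for t
      using s that mono_onD[of "{0..1}" s 0 t] mono_onD[of "{0..1}" s t 1]
      by (auto simp: reparametrization_def)
    then have "\<gamma> t = G ** mexp (s t *\<^sub>R B)" if "t \<in> {0..1}" for t
      using \<alpha> \<gamma> that by simp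
    then show "minimal_curve G H \<gamma>"
      unfolding min_iff curve_length_def using log_curve(1)[OF B s, of \<gamma>] log_curve(2)[OF B s, of \<gamma> 0 1] s
      by (simp add: reparametrization_def)
  qed
  moreover have "minimal_curve G H \<gamma> \<and> const_speed \<gamma> \<longleftrightarrow> principal_geodesic_arc G H \<gamma>" for \<gamma>
  proof
    assume "minimal_curve G H \<gamma> \<and> const_speed \<gamma>"
    then have min: "minimal_curve G H \<gamma>" and "const_speed \<gamma>" by auto
    from min_form[OF min] obtain B s where B: "skew_principal_log R B" and s: "reparametrization s"
      and \<gamma>: "\<And>t. t \<in> {0..1} \<Longrightarrow> \<gamma> t = G ** mexp (s t *\<^sub>R B)" by blast
    obtain c where c: "\<And>t. 0 \<le> t \<Longrightarrow> t \<le> 1 \<Longrightarrow> arc_length \<gamma> 0 t = c * t"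
      using \<open>const_speed \<gamma>\<close> unfolding const_speed_def by (metis diff_zero order_refl)
    have ct: "L * s t = c * t" if "0 \<le> t" "t \<le> 1" for t
      using log_curve(2)[OF B s \<gamma>, of 0 t] c[of t] that s by (simp add: reparametrization_def)
    have "c = L" using ct[of 1] s by (simp add: reparametrization_def)
    \<comment> \<open>For \<open>L = 0\<close> constant speed says nothing about \<open>s\<close>,
      but then \<open>B = 0\<close>; hence the products with \<open>B\<close> are compared, not
      \<open>s t\<close> and \<open>t\<close>.\<close>
    have sB: "s t *\<^sub>R B = t *\<^sub>R B" if "t \<in> {0..1}" for t
    proof (cases "L = 0")
      case True
      then show ?thesis using log_norm[OF B] by simp
    next
      case False
      then show ?thesis using ct[of t] \<open>c = L\<close> that by simp
    qed
    then show "principal_geodesic_arc G H \<gamma>"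
      unfolding arc_iff
    proof (intro exI[of _ B] conjI ballI B)
      show "\<gamma> t = G ** mexp (t *\<^sub>R B)" if "t \<in> {0..1}" for t
        using \<gamma>[OF that] by (simp only: sB[OF that])
    qed
  next
    assume "principal_geodesic_arc G H \<gamma>"
    then obtain B where B: "skew_principal_log R B"
      and \<gamma>: "\<And>t. t \<in> {0..1} \<Longrightarrow> \<gamma> t = G ** mexp (t *\<^sub>R B)"
      unfolding arc_iff by blast
    note curve = log_curve[OF B reparametrization_id \<gamma>]
    have "minimal_curve G H \<gamma>"
      unfolding min_iff curve_length_def using curve(1) curve(2)[of 0 1] by simp
    moreover have "const_speed \<gamma>"
      unfolding const_speed_def using curve(2) by blast
    ultimately show "minimal_curve G H \<gamma> \<and> const_speed \<gamma>" ..
  qed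
  moreover have "riem_dist G H = L"
    unfolding riem_dist_def by (rule cInf_eq_minimum) (use \<gamma>0 lower in auto)
  ultimately show ?thesis unfolding eig by blast
qed

end
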